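(* Consider a noncooperative kinetically constrained lattice gas on the box $\Lambda=[L]^d$ with empty boundary conditions and with reservoirs on the boundary, and fix a mobile cluster $\mathcal C$ with $N=|\mathcal C|$ sites. There is a constant $C>0$, depending only on the model (dimension, rates) and on the chosen mobile cluster, but not on $q$ or $L$, such that for every $q\in(0,1)$, every $L\in\mathbb N$ and every $f:\{0,1\}^\Lambda\to\mathbb R$, $$\operatorname{Var}_\mu f\le C\,q^{-N-1}L^2\,\mathcal D_{\mathrm r}f,$$ where $\mu$ is the product Bernoulli measure on $\{0,1\}^\Lambda$ (each site occupied with probability $1-q$) and $$\mathcal D_{\mathrm r}f=\mu\Big[\sum_{x,y\in\Lambda,\,x\sim y}c_{x,y}(\nabla_{x,y}f)^2\Big]+\mu\Big[\sum_{x\in\partial\Lambda}c_x(\nabla_xf)^2\Big],\qquad c_x(\eta)=q\eta(x)+(1-q)(1-\eta(x)).$$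
   Context: Let $d\ge1$ and let $e_1,\dots,e_d$ be the standard basis of $\mathbb Z^d$. Sites $x,y$ are neighbours, $x\sim y$, if $x-y\in\{\pm e_1,\dots,\pm e_d\}$. A configuration is $\eta\in\Omega=\{0,1\}^{\mathbb Z^d}$; site $x$ is empty if $\eta(x)=0$ and occupied if $\eta(x)=1$. $\eta^{x,y}$ denotes $\eta$ with the values at $x,y$ exchanged, $\eta^x$ denotes $\eta$ with the value at $x$ flipped, $\nabla_{x,y}f(\eta)=f(\eta^{x,y})-f(\eta)$, $\nabla_xf(\eta)=f(\eta^x)-f(\eta)$. For a permutation $\sigma$ of $\mathbb Z^d$, $(\sigma\eta)(y)=\eta(\sigma^{-1}(y))$; $(x_1,\dots,x_n)$ denotes a cyclic permutation; $\tau_x$ is the translation $y\mapsto y+x$. A kinetically constrained lattice gas (KCLG) is given by rates $c_{x,y}:\Omega\to\{0\}\cup[1,c_{\max}]$ ($x\sim y$, some $c_{\max}\ge1$) such that: $c_{x,y}(\eta)$ does not depend on $\eta(x),\eta(y)$; for every edge there are $\eta,\eta'$ with $c_{x,y}(\eta)\ge1$ and $c_{x,y}(\eta')=0$; $c_{x,y}$ is coordinatewise nonincreasing in $\eta$; $c_{x,y}(\eta)=c_{x+z,y+z}(\tau_z\eta)$ for all $z$; and $c_{x,y}$ depends only on $\eta$ restricted to $x+[-R,R]^d$ for some fixed $R$. Its generator is $\mathcal Lf=\sum_{x\sim y}c_{x,y}\nabla_{x,y}f$. For $q\in(0,1)$, $\mu=\mu_q$ is the product measure under which each site is independently occupied with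 probability $1-q$. A $T$-step move $M$ with domain $\mathrm{Dom}M\subseteq\Omega$ consists of maps $\eta_t:\mathrm{Dom}M\to\Omega$ ($0\le t\le T$), $x_t:\mathrm{Dom}M\to\mathbb Z^d$ and $e_t:\mathrm{Dom}M\to\{\pm e_1,\dots,\pm e_d\}$ ($0\le t<T$) with $\eta_0(\eta)=\eta$ and, for each $t<T$, $\eta_{t+1}=\eta_t^{x_t,x_t+e_t}$ and $c_{x_t,x_t+e_t}(\eta_t)\ge1$. It is deterministic if $x_t,e_t$ do not depend on $\eta$. It is compatible with a permutation $\sigma$ if for every $\eta\in\mathrm{Dom}M$ the product of transpositions $(x_{T-1},x_{T-1}+e_{T-1})\cdots(x_0,x_0+e_0)$ equals $\sigma$. For a finite $\mathcal C\subset\mathbb Z^d$, $l>0$ and $e\in\{\pm e_1,\dots,\pm e_d\}$: a translation move of $\mathcal C$ in direction $e$ in $[-l,l]^d$ is a deterministic move with domain $\{\eta:\mathcal C\text{ is empty}\}$, compatible with a permutation $\sigma$ satisfying $\sigma(y)=y+e$ for all $y\in\mathcal C$, with $x_t,x_t+e_t\in[-l,l]^d$ for all $t$. An exchange move using $\mathcal C$ in direction $e$ in $[-l,l]^d$ is a deterministic move with domain $\{\eta:\mathcal C\text{ is empty}\}$, compatible with the transposition of $le$ and $(l+1)e$, with $x_t,x_t+e_t\in[-l,l]^d\cup\{(l+1)e\}$ for all $t$. $\mathcal C$ is a mobile cluster if for some $l>0$ both moves exist for all $2d$ directions $e$. The KCLG is noncooperative if a mobile cluster exists. On the box $\Lambda=[L]^d$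 with empty boundary conditions, the rate $c_{x,y}(\eta)$ for $\eta\in\{0,1\}^\Lambda$, $x,y\in\Lambda$, means $c_{x,y}(\bar\eta)$ where $\bar\eta=\eta$ on $\Lambda$ and $\bar\eta=0$ outside $\Lambda$. $\partial\Lambda$ is the set of sites of $\Lambda$ having a neighbour outside $\Lambda$. The dynamics with reservoirs has generator $\mathcal L_{\mathrm r}f=\sum_{x,y\in\Lambda,x\sim y}c_{x,y}\nabla_{x,y}f+\sum_{x\in\partial\Lambda}c_x\nabla_xf$, with $c_x$ as in the claim. *)

theory Defs
  imports "HOL-Analysis.Analysis"
begin

text \<open>Sites of Z^d are vectors int^'d, with d = CARD('d). A configuration is a
  predicate on sites (True = occupied, False = empty).\<close>

type_synonym 'd site = "int ^ 'd"
type_synonym 'd config = "'d site \<Rightarrow> bool"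

definition unitv :: "'d::finite \<Rightarrow> int \<Rightarrow> 'd site" where
  "unitv i s = (\<chi> j. if j = i then s else 0)"

definition dirs :: "('d::finite) site set" where
  "dirs = {v. \<exists>i. v = unitv i 1 \<or> v = unitv i (-1)}"

definition nbr :: "('d::finite) site \<Rightarrow> 'd site \<Rightarrow> bool" where
  "nbr x y \<longleftrightarrow> x - y \<in> dirs"

definition swp :: "'d config \<Rightarrow> 'd site \<Rightarrow> 'd site \<Rightarrow> 'd config" where
  "swp \<eta> x y = \<eta>(x := \<eta> y, y := \<eta> x)"

definition flp :: "'d config \<Rightarrow> 'd site \<Rightarrow> 'd config" where
  "flp \<eta> x = \<eta>(x := \<not> \<eta> x)"

definition transl :: "('d::finite) site \<Rightarrow> 'd config \<Rightarrow> 'd config" where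
  "transl z \<eta> = (\<lambda>w. \<eta> (w - z))"

definition cube :: "('d::finite) site \<Rightarrow> int \<Rightarrow> 'd site set" where
  "cube x R = {z. \<forall>i. \<bar>z$i - x$i\<bar> \<le> R}"

definition KCLG :: "(('d::finite) site \<Rightarrow> 'd site \<Rightarrow> 'd config \<Rightarrow> real) \<Rightarrow> bool" where
  "KCLG c \<longleftrightarrow>
     (\<exists>cmax\<ge>1. \<forall>x y \<eta>. nbr x y \<longrightarrow> c x y \<eta> = 0 \<or> (1 \<le> c x y \<eta> \<and> c x y \<eta> \<le> cmax))
   \<and> (\<forall>x y \<eta> a b. nbr x y \<longrightarrow> c x y (\<eta>(x := a, y := b)) = c x y \<eta>)
   \<and> (\<forall>x y. nbr x y \<longrightarrow> (\<exists>\<eta> \<eta>'. c x y \<eta> \<ge> 1 \<and> c x y \<eta>' = 0))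
   \<and> (\<forall>x y \<eta> \<eta>'. nbr x y \<longrightarrow> (\<forall>z. \<eta> z \<longrightarrow> \<eta>' z) \<longrightarrow> c x y \<eta>' \<le> c x y \<eta>)
   \<and> (\<forall>x y z \<eta>. nbr x y \<longrightarrow> c x y \<eta> = c (x + z) (y + z) (transl z \<eta>))
   \<and> (\<exists>R::nat. \<forall>x y \<eta> \<eta>'. nbr x y \<longrightarrow> (\<forall>z\<in>cube x (int R). \<eta> z = \<eta>' z)
          \<longrightarrow> c x y \<eta> = c x y \<eta>')"

text \<open>Deterministic moves: a list of steps (x_t, e_t), t = 0..T-1.\<close>
type_synonym 'd move = "('d site \<times> 'd site) list"

fun run :: "'d config \<Rightarrow> ('d::finite) move \<Rightarrow> 'd config" where
  "run \<eta> [] = \<eta>"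
| "run \<eta> ((x, e) # ms) = run (swp \<eta> x (x + e)) ms"

fun legal :: "(('d::finite) site \<Rightarrow> 'd site \<Rightarrow> 'd config \<Rightarrow> real) \<Rightarrow> 'd config \<Rightarrow> 'd move \<Rightarrow> bool" where
  "legal c \<eta> [] = True"
| "legal c \<eta> ((x, e) # ms) = (e \<in> dirs \<and> c x (x + e) \<eta> \<ge> 1 \<and> legal c (swp \<eta> x (x + e)) ms)"

definition transpos :: "'a \<Rightarrow> 'a \<Rightarrow> 'a \<Rightarrow> 'a" where
  "transpos a b z = (if z = a then b else if z = b then a else z)"

fun mperm :: "('d::finite) move \<Rightarrow> 'd site \<Rightarrow> 'd site" where
  "mperm [] = id"
| "mperm ((x, e) # ms) = mperm ms \<circ> transpos x (x + e)"

definition sites_of :: "('d::finite) move \<Rightarrow> 'd site set" where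
  "sites_of ms = (\<Union>(x, e)\<in>set ms. {x, x + e})"

definition empty_on :: "'d site set \<Rightarrow> 'd config set" where
  "empty_on A = {\<eta>. \<forall>y\<in>A. \<not> \<eta> y}"

definition translation_move ::
  "(('d::finite) site \<Rightarrow> 'd site \<Rightarrow> 'd config \<Rightarrow> real) \<Rightarrow> 'd site set \<Rightarrow> 'd site \<Rightarrow> nat \<Rightarrow> 'd move \<Rightarrow> bool" where
  "translation_move c Cl e l ms \<longleftrightarrow>
     (\<forall>\<eta>\<in>empty_on Cl. legal c \<eta> ms)
   \<and> (\<forall>y\<in>Cl. mperm ms y = y + e)
   \<and> sites_of ms \<subseteq> cube 0 (int l)"

definition smul :: "int \<Rightarrow> ('d::finite) site \<Rightarrow> 'd site" where
  "smul k v = (\<chi> i. k * v$i)"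

definition exchange_move ::
  "(('d::finite) site \<Rightarrow> 'd site \<Rightarrow> 'd config \<Rightarrow> real) \<Rightarrow> 'd site set \<Rightarrow> 'd site \<Rightarrow> nat \<Rightarrow> 'd move \<Rightarrow> bool" where
  "exchange_move c Cl e l ms \<longleftrightarrow>
     (\<forall>\<eta>\<in>empty_on Cl. legal c \<eta> ms)
   \<and> mperm ms = transpos (smul (int l) e) (smul (int l + 1) e)
   \<and> sites_of ms \<subseteq> cube 0 (int l) \<union> {smul (int l + 1) e}"

definition mobile_cluster ::
  "(('d::finite) site \<Rightarrow> 'd site \<Rightarrow> 'd config \<Rightarrow> real) \<Rightarrow> 'd site set \<Rightarrow> bool" where
  "mobile_cluster c Cl \<longleftrightarrow> finite Cl \<and>
     (\<exists>l>0. \<forall>e\<in>dirs. (\<exists>ms. translation_move c Cl e l ms) \<and> (\<exists>ms. exchange_move c Cl e l ms))"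

definition noncooperative :: "(('d::finite) site \<Rightarrow> 'd site \<Rightarrow> 'd config \<Rightarrow> real) \<Rightarrow> bool" where
  "noncooperative c \<longleftrightarrow> (\<exists>Cl. mobile_cluster c Cl)"

definition box :: "nat \<Rightarrow> ('d::finite) site set" where
  "box L = {z. \<forall>i. 1 \<le> z$i \<and> z$i \<le> int L}"

definition bdry :: "nat \<Rightarrow> ('d::finite) site set" where
  "bdry L = {x\<in>box L. \<exists>y. nbr x y \<and> y \<notin> box L}"

text \<open>Configurations in {0,1}^Lambda, identified with their extension by empty
  sites outside Lambda (empty boundary condition).\<close>
definition confs :: "nat \<Rightarrow> ('d::finite) config set" where
  "confs L = {\<eta>. \<forall>x. x \<notin> box L \<longrightarrow> \<not> \<eta> x}"

definition weight :: "real \<Rightarrow> nat \<Rightarrow> ('d::finite) config \<Rightarrow> real" where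
  "weight q L \<eta> = (\<Prod>x\<in>box L. if \<eta> x then 1 - q else q)"

definition expect :: "real \<Rightarrow> nat \<Rightarrow> (('d::finite) config \<Rightarrow> real) \<Rightarrow> real" where
  "expect q L g = (\<Sum>\<eta>\<in>confs L. weight q L \<eta> * g \<eta>)"

definition var :: "real \<Rightarrow> nat \<Rightarrow> (('d::finite) config \<Rightarrow> real) \<Rightarrow> real" where
  "var q L f = expect q L (\<lambda>\<eta>. (f \<eta>)\<^sup>2) - (expect q L f)\<^sup>2"

definition res_rate :: "real \<Rightarrow> ('d::finite) config \<Rightarrow> 'd site \<Rightarrow> real" where
  "res_rate q \<eta> x = q * of_bool (\<eta> x) + (1 - q) * (1 - of_bool (\<eta> x))"

definition dirichlet_r ::
  "(('d::finite) site \<Rightarrow> 'd site \<Rightarrow> 'd config \<Rightarrow> real) \<Rightarrow> real \<Rightarrow> nat \<Rightarrow> ('d config \<Rightarrow> real) \<Rightarrow> real" where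
  "dirichlet_r c q L f =
     expect q L (\<lambda>\<eta>. \<Sum>x\<in>box L. \<Sum>y\<in>{y\<in>box L. nbr x y}. c x y \<eta> * (f (swp \<eta> x y) - f \<eta>)\<^sup>2)
   + expect q L (\<lambda>\<eta>. \<Sum>x\<in>bdry L. res_rate q \<eta> x * (f (flp \<eta> x) - f \<eta>)\<^sup>2)"

end

theory Submission
  imports Defs
begin

text \<open>Surround the box by a finite exterior of independent Bernoulli sites and regard \<open>f\<close> as a
  function \<open>F\<close> on the larger set that ignores the exterior. Exchanging a boundary site with an
  exterior neighbour then costs, on average, exactly the reservoir term, and monotonicity of the
  rates makes every legal exchange in the larger set legal in the box with empty boundary, so
  moves may leave the box freely.

  By tensorisation of the variance it suffices to flip each site \<open>x\<close>, that is, to exchange it with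
  the exterior site \<open>x - L e\<close>. With probability \<open>q ^ card Cl\<close>, independently of the box and of that
  site, there is an empty cluster just behind it. This cluster carries the content of \<open>x - L e\<close>
  to \<open>x\<close> in \<open>L\<close> steps and then undoes its own motion. Every partial move preserves the measure, so
  Cauchy-Schwarz costs a factor \<open>L\<close>, and for a given step number different \<open>x\<close> use different
  translates of the same finite move, so that summing over the steps costs the second factor \<open>L\<close>.\<close>

section \<open>Bernoulli expectations over finite sets of sites\<close>

definition confs_on :: "'a set \<Rightarrow> ('a \<Rightarrow> bool) set" where
  "confs_on S = {\<eta>. \<forall>x. x \<notin> S \<longrightarrow> \<not> \<eta> x}"

definition bweight :: "real \<Rightarrow> 'a set \<Rightarrow> ('a \<Rightarrow> bool) \<Rightarrow> real" where
  "bweight q S \<eta> = (\<Prod>x\<in>S. if \<eta> x then 1 - q else q)"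

definition bexpect :: "real \<Rightarrow> 'a set \<Rightarrow> (('a \<Rightarrow> bool) \<Rightarrow> real) \<Rightarrow> real" where
  "bexpect q S g = (\<Sum>\<eta>\<in>confs_on S. bweight q S \<eta> * g \<eta>)"

lemma expect_eq_bexpect: "expect q L g = bexpect q (box L) g"
  by (simp add: expect_def bexpect_def confs_def confs_on_def weight_def bweight_def)

lemma bexpect_cong:
  "(\<And>\<eta>. \<eta> \<in> confs_on S \<Longrightarrow> g \<eta> = h \<eta>) \<Longrightarrow> bexpect q S g = bexpect q S h"
  by (simp add: bexpect_def)

lemma bweight_nonneg: "0 \<le> q \<Longrightarrow> q \<le> 1 \<Longrightarrow> 0 \<le> bweight q S \<eta>"
  by (auto simp: bweight_def intro!: prod_nonneg)

lemma bexpect_mono: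
  assumes "0 \<le> q" "q \<le> 1" "\<And>\<eta>. \<eta> \<in> confs_on S \<Longrightarrow> g \<eta> \<le> h \<eta>"
  shows "bexpect q S g \<le> bexpect q S h"
  unfolding bexpect_def using assms by (intro sum_mono mult_left_mono bweight_nonneg) auto

lemma bexpect_nonneg:
  assumes "0 \<le> q" "q \<le> 1" "\<And>\<eta>. \<eta> \<in> confs_on S \<Longrightarrow> 0 \<le> g \<eta>"
  shows "0 \<le> bexpect q S g"
  unfolding bexpect_def using assms by (intro sum_nonneg mult_nonneg_nonneg bweight_nonneg) auto

lemma bexpect_zero [simp]: "bexpect q S (\<lambda>_. 0) = 0"
  by (simp add: bexpect_def)

lemma bexpect_add: "bexpect q S (\<lambda>\<eta>. g \<eta> + h \<eta>) = bexpect q S g + bexpect q S h"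
  by (simp add: bexpect_def sum.distrib algebra_simps)

lemma bexpect_cmult: "bexpect q S (\<lambda>\<eta>. a * g \<eta>) = a * bexpect q S g"
  by (simp add: bexpect_def sum_distrib_left algebra_simps)

lemma bexpect_sum: "bexpect q S (\<lambda>\<eta>. \<Sum>i\<in>I. g i \<eta>) = (\<Sum>i\<in>I. bexpect q S (g i))"
  unfolding bexpect_def sum_distrib_left by (rule sum.swap)

lemma confs_on_insert:
  "confs_on (insert a S) = confs_on S \<union> (\<lambda>\<eta>. \<eta>(a := True)) ` confs_on S" if "a \<notin> S"
proof
  show "confs_on (insert a S) \<subseteq> confs_on S \<union> (\<lambda>\<eta>. \<eta>(a := True)) ` confs_on S"
  proof
    fix \<eta> assume h: "\<eta> \<in> confs_on (insert a S)"
    show "\<eta> \<in> confs_on S \<union> (\<lambda>\<eta>. \<eta>(a := True)) ` confs_on S"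
    proof (cases "\<eta> a")
      case True
      then have "\<eta> = (\<eta>(a := False))(a := True)" "\<eta>(a := False) \<in> confs_on S"
        using h by (auto simp: confs_on_def fun_eq_iff)
      then show ?thesis by blast
    next
      case False
      then show ?thesis using h by (auto simp: confs_on_def)
    qed
  qed
qed (use that in \<open>auto simp: confs_on_def\<close>)

lemma finite_confs_on: "finite S \<Longrightarrow> finite (confs_on S)"
proof (induction S rule: finite_induct)
  case empty
  have "confs_on {} = {\<lambda>_::'a. False}" by (auto simp: confs_on_def)
  then show ?case by simp
qed (simp add: confs_on_insert)

text \<open>Conditioning on the value at \<open>a\<close>: the configurations on the enlarged set
  split into those with \<open>a\<close> empty and those with \<open>a\<close> occupied. The
  inductions over sites below rest on this.\<close>

lemma bexpect_insert:
  assumes "finite S" "a \<notin> S"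
  shows "bexpect q (insert a S) g =
    q * bexpect q S g + (1 - q) * bexpect q S (\<lambda>\<eta>. g (\<eta>(a := True)))"
proof -
  let ?u = "\<lambda>\<eta>. \<eta>(a := True)"
  have inj: "inj_on ?u (confs_on S)"
  proof (rule inj_onI)
    fix \<eta> \<zeta> assume h: "\<eta> \<in> confs_on S" "\<zeta> \<in> confs_on S" "?u \<eta> = ?u \<zeta>"
    have "\<eta> a = \<zeta> a" using h assms by (auto simp: confs_on_def)
    moreover have "\<eta> x = \<zeta> x" if "x \<noteq> a" for x
      using fun_cong[OF h(3), of x] that by simp
    ultimately show "\<eta> = \<zeta>" by (intro ext) metis
  qed
  have disj: "confs_on S \<inter> ?u ` confs_on S = {}"
    using assms by (auto simp: confs_on_def)
  have w0: "bweight q (insert a S) \<eta> = q * bweight q S \<eta>" if "\<eta> \<in> confs_on S" for \<eta>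
    using that assms by (auto simp: bweight_def confs_on_def)
  have w1: "bweight q (insert a S) (?u \<eta>) = (1 - q) * bweight q S \<eta>" for \<eta>
  proof -
    have "(\<Prod>x\<in>S. if (?u \<eta>) x then 1 - q else q) = (\<Prod>x\<in>S. if \<eta> x then 1 - q else q)"
      using assms by (intro prod.cong) auto
    then show ?thesis using assms by (simp add: bweight_def del: fun_upd_apply) simp
  qed
  have "bexpect q (insert a S) g = (\<Sum>\<eta>\<in>confs_on S. bweight q (insert a S) \<eta> * g \<eta>)
      + (\<Sum>\<eta>\<in>?u ` confs_on S. bweight q (insert a S) \<eta> * g \<eta>)"
    unfolding bexpect_def confs_on_insert[OF assms(2)]
    using disj assms by (intro sum.union_disjoint) (auto simp: finite_confs_on)
  also have "(\<Sum>\<eta>\<in>?u ` confs_on S. bweight q (insert a S) \<eta> * g \<eta>)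
      = (\<Sum>\<eta>\<in>confs_on S. bweight q (insert a S) (?u \<eta>) * g (?u \<eta>))"
    using inj by (simp add: sum.reindex)
  finally show ?thesis
    by (simp add: bexpect_def w0 w1 sum_distrib_left mult.assoc cong: sum.cong del: fun_upd_apply)
qed

lemma bexpect_remove:
  assumes "finite S" "a \<in> S"
  shows "bexpect q S g = bexpect q (S - {a}) (\<lambda>\<eta>. q * g \<eta> + (1 - q) * g (\<eta>(a := True)))"
  using bexpect_insert[of "S - {a}" a q g] assms
  by (simp add: insert_absorb bexpect_add bexpect_cmult)

text \<open>\<open>H\<close> is the conditional expectation of \<open>g\<close> given all sites but
  \<open>a\<close>; the hypothesis, taken for both values of \<open>b\<close>, forces
  \<open>H\<close> to ignore \<open>a\<close>.\<close>

lemma bexpect_integrate_site: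
  assumes "finite S" "a \<in> S"
    and H: "\<And>\<eta> b. H (\<eta>(a := b)) = q * g (\<eta>(a := False)) + (1 - q) * g (\<eta>(a := True))"
  shows "bexpect q S g = bexpect q S H"
proof -
  have g0: "\<eta>(a := False) = \<eta>" if "\<eta> \<in> confs_on (S - {a})" for \<eta>
    using that by (auto simp: confs_on_def fun_eq_iff)
  have "q * g \<eta> + (1 - q) * g (\<eta>(a := True)) = q * H \<eta> + (1 - q) * H (\<eta>(a := True))"
    if "\<eta> \<in> confs_on (S - {a})" for \<eta>
    using H[of \<eta> True] H[of \<eta> False] g0[OF that] by (simp add: algebra_simps)
  then show ?thesis
    unfolding bexpect_remove[OF assms(1,2), of q g] bexpect_remove[OF assms(1,2), of q H]
    by (intro bexpect_cong) auto
qed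

lemma bexpect_superset:
  assumes "finite S" "B \<subseteq> S" "\<And>\<eta> a b. a \<notin> B \<Longrightarrow> g (\<eta>(a := b)) = g \<eta>"
  shows "bexpect q S g = bexpect q B g"
proof -
  have "finite T \<Longrightarrow> T \<inter> B = {} \<Longrightarrow> bexpect q (B \<union> T) g = bexpect q B g" for T
  proof (induction T rule: finite_induct)
    case (insert a T)
    have "finite (B \<union> T)" "a \<notin> B \<union> T" "a \<notin> B"
      using insert assms finite_subset by auto
    then have "bexpect q (insert a (B \<union> T)) g = bexpect q (B \<union> T) g"
      using assms(3) by (simp add: bexpect_insert algebra_simps)
    then show ?case using insert by simp
  qed simp
  from this[of "S - B"] have "bexpect q (B \<union> (S - B)) g = bexpect q B g"
    using assms(1) by blast
  then show ?thesis using assms(2) by (simp add: Un_absorb1)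
qed

text \<open>Independence: each site of \<open>A\<close> contributes one factor \<open>q\<close>,
  because \<open>G\<close> ignores it. The power of \<open>q\<close> in the final bound originates
  here.\<close>

lemma bexpect_all_empty:
  assumes "finite S" "A \<subseteq> S" "\<And>\<eta> a b. a \<in> A \<Longrightarrow> G (\<eta>(a := b)) = G \<eta>"
  shows "bexpect q S (\<lambda>\<eta>. of_bool (\<forall>a\<in>A. \<not> \<eta> a) * G \<eta>) = q ^ card A * bexpect q S G"
proof -
  have "finite A" using assms finite_subset by blast
  then show ?thesis using assms(2,3)
  proof (induction A rule: finite_induct)
    case (insert a A)
    have "bexpect q S (\<lambda>\<eta>. of_bool (\<forall>a\<in>insert a A. \<not> \<eta> a) * G \<eta>)
      = bexpect q S (\<lambda>\<eta>. q * (of_bool (\<forall>a\<in>A. \<not> \<eta> a) * G \<eta>))"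
    proof (rule bexpect_integrate_site[where a = a])
      fix \<eta> b
      have "(\<forall>a'\<in>A. \<not> (\<eta>(a := b')) a') = (\<forall>a'\<in>A. \<not> \<eta> a')" for b'
        using insert by auto
      then show "q * (of_bool (\<forall>a'\<in>A. \<not> (\<eta>(a := b)) a') * G (\<eta>(a := b)))
        = q * (of_bool (\<forall>a'\<in>insert a A. \<not> (\<eta>(a := False)) a') * G (\<eta>(a := False)))
        + (1 - q) * (of_bool (\<forall>a'\<in>insert a A. \<not> (\<eta>(a := True)) a') * G (\<eta>(a := True)))"
        by (simp add: insert.prems(2) del: fun_upd_apply) simp
    qed (use insert assms in auto)
    also have "\<dots> = q * (q ^ card A * bexpect q S G)"
      using insert by (simp add: bexpect_cmult)
    finally show ?case using insert by simp
  qed simp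
qed

section \<open>The tensorised variance inequality\<close>

text \<open>Efron-Stein inequality, by induction on \<open>S\<close>: averaging over the new site
  \<open>a\<close> splits the variance into that of the conditional mean \<open>h\<close> and a
  single-site term, and the differences of \<open>h\<close> are controlled by convexity.\<close>

lemma bexpect_variance_le:
  fixes f :: "('a \<Rightarrow> bool) \<Rightarrow> real"
  assumes "finite S" "0 \<le> q" "q \<le> 1"
  shows "bexpect q S (\<lambda>\<eta>. (f \<eta>)\<^sup>2) - (bexpect q S f)\<^sup>2
    \<le> (\<Sum>x\<in>S. q * (1 - q) * bexpect q S (\<lambda>\<eta>. (f (\<eta>(x := \<not> \<eta> x)) - f \<eta>)\<^sup>2))"
  using assms(1)
proof (induction S arbitrary: f rule: finite_induct)
  case empty
  have "confs_on {} = {\<lambda>_::'a. False}" by (auto simp: confs_on_def)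
  then show ?case by (simp add: bexpect_def bweight_def)
next
  case (insert a S)
  let ?u = "\<lambda>\<eta>. \<eta>(a := True)"
  let ?E = "bexpect q S"
  define h where "h \<eta> = q * f \<eta> + (1 - q) * f (?u \<eta>)" for \<eta>
  define D where "D g x \<eta> = (g (\<eta>(x := \<not> \<eta> x)) - g \<eta>)\<^sup>2" for g :: "('a \<Rightarrow> bool) \<Rightarrow> real" and x \<eta>
  have ins: "bexpect q (insert a S) g = ?E (\<lambda>\<eta>. q * g \<eta> + (1 - q) * g (?u \<eta>))" for g
    using insert by (simp add: bexpect_insert bexpect_add bexpect_cmult)
  have Da: "bexpect q (insert a S) (D f a) = ?E (\<lambda>\<eta>. (f (?u \<eta>) - f \<eta>)\<^sup>2)"
    unfolding ins
  proof (rule bexpect_cong)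
    fix \<eta> assume "\<eta> \<in> confs_on S"
    then have "\<not> \<eta> a" "\<eta>(a := False) = \<eta>" using insert by (auto simp: confs_on_def fun_eq_iff)
    then have "D f a \<eta> = (f (?u \<eta>) - f \<eta>)\<^sup>2" "D f a (?u \<eta>) = (f \<eta> - f (?u \<eta>))\<^sup>2"
      by (simp_all add: D_def)
    then show "q * D f a \<eta> + (1 - q) * D f a (?u \<eta>) = (f (?u \<eta>) - f \<eta>)\<^sup>2"
      by (simp add: power2_eq_square algebra_simps)
  qed
  \<comment> \<open>Jensen's inequality for the square; the deficit is
    \<open>q * (1 - q) * (s - t)\<^sup>2\<close>.\<close>
  have conv: "?E (D h x) \<le> bexpect q (insert a S) (D f x)" if "x \<in> S" for x
    unfolding ins
  proof (rule bexpect_mono[OF assms(2,3)])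
    fix \<eta> assume "\<eta> \<in> confs_on S"
    have ne: "x \<noteq> a" using that insert by auto
    define s where "s = f (\<eta>(x := \<not> \<eta> x)) - f \<eta>"
    define t where "t = f ((?u \<eta>)(x := \<not> \<eta> x)) - f (?u \<eta>)"
    have "D h x \<eta> = (q * s + (1 - q) * t)\<^sup>2"
      using ne by (simp add: D_def h_def s_def t_def algebra_simps fun_upd_twist)
    moreover have "q * D f x \<eta> + (1 - q) * D f x (?u \<eta>) = q * s\<^sup>2 + (1 - q) * t\<^sup>2"
      using ne by (simp add: D_def s_def t_def)
    moreover have "q * s\<^sup>2 + (1 - q) * t\<^sup>2 - (q * s + (1 - q) * t)\<^sup>2 = q * (1 - q) * (s - t)\<^sup>2"
      by (simp add: power2_eq_square algebra_simps)
    moreover have "0 \<le> q * (1 - q) * (s - t)\<^sup>2" using assms by simp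
    ultimately show "D h x \<eta> \<le> q * D f x \<eta> + (1 - q) * D f x (?u \<eta>)" by linarith
  qed
  have "q * (f \<eta>)\<^sup>2 + (1 - q) * (f (?u \<eta>))\<^sup>2
      = (h \<eta>)\<^sup>2 + q * (1 - q) * (f (?u \<eta>) - f \<eta>)\<^sup>2" for \<eta>
    by (simp add: h_def power2_eq_square algebra_simps)
  then have "bexpect q (insert a S) (\<lambda>\<eta>. (f \<eta>)\<^sup>2)
      = ?E (\<lambda>\<eta>. (h \<eta>)\<^sup>2) + q * (1 - q) * bexpect q (insert a S) (D f a)"
    unfolding Da by (simp add: ins bexpect_add bexpect_cmult)
  moreover have "(bexpect q (insert a S) f)\<^sup>2 = (?E h)\<^sup>2" by (simp add: ins h_def[abs_def])
  moreover have "?E (\<lambda>\<eta>. (h \<eta>)\<^sup>2) - (?E h)\<^sup>2 \<le> (\<Sum>x\<in>S. q * (1 - q) * ?E (D h x))"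
    using insert.IH[of h] by (simp only: D_def[abs_def])
  moreover have "\<dots> \<le> (\<Sum>x\<in>S. q * (1 - q) * bexpect q (insert a S) (D f x))"
    using assms conv by (intro sum_mono mult_left_mono) auto
  moreover have "(\<Sum>x\<in>insert a S. q * (1 - q) * bexpect q (insert a S) (D f x))
    = q * (1 - q) * bexpect q (insert a S) (D f a)
      + (\<Sum>x\<in>S. q * (1 - q) * bexpect q (insert a S) (D f x))"
    using insert by simp
  ultimately have "bexpect q (insert a S) (\<lambda>\<eta>. (f \<eta>)\<^sup>2) - (bexpect q (insert a S) f)\<^sup>2
    \<le> (\<Sum>x\<in>insert a S. q * (1 - q) * bexpect q (insert a S) (D f x))" by linarith
  then show ?case by (simp only: D_def[abs_def])
qed

section \<open>Moves\<close>

lemma transpos_transpos [simp]: "transpos a b (transpos a b z) = z"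
  by (simp add: transpos_def)

lemma bij_transpos: "bij (transpos a b)"
  by (rule involuntory_imp_bij) simp

lemma swp_eq_comp: "swp \<eta> a b = \<eta> \<circ> transpos a b"
  by (auto simp: swp_def transpos_def fun_eq_iff)

lemma inj_transpos: "inj g \<Longrightarrow> g (transpos a b z) = transpos (g a) (g b) (g z)"
  by (simp add: transpos_def inj_eq)

lemma swp_swp_transpos:
  "swp (swp \<eta> a b) x y = swp (swp \<eta> x y) (transpos x y a) (transpos x y b)"
proof
  fix w
  have h: "transpos x y (transpos a b (transpos x y w)) = transpos (transpos x y a) (transpos x y b) w"
    by (simp add: inj_transpos[OF bij_is_inj[OF bij_transpos], of x y])
  show "swp (swp \<eta> a b) x y w = swp (swp \<eta> x y) (transpos x y a) (transpos x y b) w"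
    unfolding swp_eq_comp comp_apply h[symmetric] transpos_transpos ..
qed

lemma swp_upd: "u \<noteq> a \<Longrightarrow> u \<noteq> b \<Longrightarrow> swp (\<eta>(u := v)) a b = (swp \<eta> a b)(u := v)"
  by (auto simp: swp_def fun_eq_iff)

lemma swp_commute: "swp \<eta> a b = swp \<eta> b a"
  by (auto simp: swp_def fun_eq_iff)

lemma swp_empty_on_iff: "a \<notin> A \<Longrightarrow> b \<notin> A \<Longrightarrow> swp \<eta> a b \<in> empty_on A \<longleftrightarrow> \<eta> \<in> empty_on A"
  by (auto simp: swp_def empty_on_def)

text \<open>The product measure is exchangeable: a swap inside \<open>S\<close> permutes
  \<open>confs_on S\<close> and merely reorders the factors of the weight.\<close>

lemma bexpect_swp:
  assumes "a \<in> S" "b \<in> S"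
  shows "bexpect q S (\<lambda>\<eta>. g (swp \<eta> a b)) = bexpect q S g"
proof -
  have bij: "bij_betw (\<lambda>\<eta>. swp \<eta> a b) (confs_on S) (confs_on S)"
  proof (rule bij_betwI[where g = "\<lambda>\<eta>. swp \<eta> a b"])
    show "(\<lambda>\<eta>. swp \<eta> a b) \<in> confs_on S \<rightarrow> confs_on S"
      using assms by (auto simp: confs_on_def swp_def)
    then show "(\<lambda>\<eta>. swp \<eta> a b) \<in> confs_on S \<rightarrow> confs_on S" .
  qed (auto simp: swp_def fun_eq_iff)
  have bijS: "bij_betw (transpos a b) S S"
    by (rule bij_betwI[where g = "transpos a b"]) (use assms in \<open>auto simp: transpos_def\<close>)
  have w: "bweight q S (swp \<eta> a b) = bweight q S \<eta>" for \<eta>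
    unfolding bweight_def swp_eq_comp o_def
    by (rule prod.reindex_bij_betw[OF bijS])
  have "(\<Sum>\<eta>\<in>confs_on S. bweight q S \<eta> * g (swp \<eta> a b))
    = (\<Sum>\<eta>\<in>confs_on S. bweight q S (swp \<eta> a b) * g (swp \<eta> a b))" by (simp add: w)
  also have "\<dots> = (\<Sum>\<eta>\<in>confs_on S. bweight q S \<eta> * g \<eta>)"
    by (rule sum.reindex_bij_betw[OF bij])
  finally show ?thesis by (simp add: bexpect_def)
qed

lemma sites_of_Nil [simp]: "sites_of [] = {}"
  by (simp add: sites_of_def)

lemma sites_of_Cons [simp]: "sites_of ((x, e) # ms) = {x, x + e} \<union> sites_of ms"
  by (simp add: sites_of_def)

lemma sites_of_append [simp]: "sites_of (ms @ ms') = sites_of ms \<union> sites_of ms'"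
  by (simp add: sites_of_def)

lemma bexpect_run:
  "sites_of ms \<subseteq> S \<Longrightarrow> bexpect q S (\<lambda>\<eta>. g (run \<eta> ms)) = bexpect q S g"
proof (induction ms arbitrary: g)
  case (Cons m ms)
  obtain x e where m: "m = (x, e)" by (cases m)
  have "bexpect q S (\<lambda>\<eta>. g (run \<eta> (m # ms))) = bexpect q S (\<lambda>\<eta>. g (run \<eta> ms))"
    using bexpect_swp[of x S "x + e" q "\<lambda>\<eta>. g (run \<eta> ms)"] Cons.prems m by simp
  then show ?case using Cons m by simp
qed simp

lemma legal_append: "legal c \<eta> (ms @ ms') \<longleftrightarrow> legal c \<eta> ms \<and> legal c (run \<eta> ms) ms'"
  by (induction ms arbitrary: \<eta>) auto

lemma mperm_append: "mperm (ms @ ms') = mperm ms' \<circ> mperm ms"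
  by (induction ms) (auto simp: fun_eq_iff)

lemma bij_mperm: "bij (mperm ms)"
proof (induction ms)
  case Nil
  show ?case unfolding mperm.simps by (rule bij_id)
next
  case (Cons m ms)
  obtain x e where "m = (x, e)" by (cases m)
  then show ?case using bij_comp[OF bij_transpos Cons.IH] by (simp only: mperm.simps)
qed

lemma mperm_outside: "y \<notin> sites_of ms \<Longrightarrow> mperm ms y = y"
  by (induction ms) (auto simp: transpos_def)

text \<open>\<open>mperm\<close> follows contents forward in time: each step carries the content of
  \<open>y\<close> to its image under the transposition of that step.\<close>

lemma run_mperm: "run \<eta> ms (mperm ms y) = \<eta> y"
proof (induction ms arbitrary: \<eta> y)
  case (Cons m ms)
  obtain x e where "m = (x, e)" by (cases m)
  then have "run \<eta> (m # ms) (mperm (m # ms) y) = swp \<eta> x (x + e) (transpos x (x + e) y)"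
    using Cons.IH by simp
  then show ?case by (simp add: swp_eq_comp)
qed simp

text \<open>Iterated conjugation of transpositions. It is the device that reduces a long exchange to
  a shorter one after the cluster has moved.\<close>

lemma run_swp: "run (swp \<eta> a b) ms = swp (run \<eta> ms) (mperm ms a) (mperm ms b)"
proof (induction ms arbitrary: \<eta> a b)
  case (Cons m ms)
  obtain x e where "m = (x, e)" by (cases m)
  then show ?case using Cons by (simp add: swp_swp_transpos[of \<eta> a b x "x + e"])
qed simp

lemma run_eq_swp:
  assumes "mperm ms = transpos a b"
  shows "run \<eta> ms = swp \<eta> a b"
proof
  fix y
  show "run \<eta> ms y = swp \<eta> a b y"
    using run_mperm[of \<eta> ms "transpos a b y"] by (simp add: assms swp_eq_comp)
qed

lemma legal_dirs: "legal c \<eta> ms \<Longrightarrow> (x, e) \<in> set ms \<Longrightarrow> e \<in> dirs"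
  by (induction ms arbitrary: \<eta>) auto

section \<open>Translates of moves\<close>

definition shift :: "('d::finite) site \<Rightarrow> 'd move \<Rightarrow> 'd move" where
  "shift z ms = map (\<lambda>(x, e). (x + z, e)) ms"

lemma shift_simps [simp]:
  "shift z [] = []" "shift z ((x, e) # ms) = (x + z, e) # shift z ms"
  by (simp_all add: shift_def)

lemma sites_of_shift: "sites_of (shift z ms) = (\<lambda>y. y + z) ` sites_of ms"
  by (induction ms) (auto simp: algebra_simps)

lemma mperm_shift: "mperm (shift z ms) (y + z) = mperm ms y + z"
proof (induction ms arbitrary: y)
  case (Cons m ms)
  obtain x e where "m = (x, e)" by (cases m)
  moreover have "transpos (x + z) (x + z + e) (y + z) = transpos x (x + e) y + z"
    by (auto simp: transpos_def algebra_simps)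
  ultimately show ?case using Cons by simp
qed simp

lemma neg_dirs: "e \<in> dirs \<Longrightarrow> - e \<in> dirs"
  unfolding dirs_def unitv_def by (auto simp: vec_eq_iff)

lemma nbr_add: "e \<in> dirs \<Longrightarrow> nbr x (x + e)"
  by (simp add: nbr_def neg_dirs)

text \<open>Translation invariance of the rates, applied at each step; a move built near the origin
  thereby serves at every place.\<close>

lemma legal_shift:
  assumes inv: "\<And>x y z \<eta>. nbr x y \<Longrightarrow> c x y \<eta> = c (x + z) (y + z) (transl z \<eta>)"
  shows "legal c \<eta> (shift z ms) \<longleftrightarrow> legal c (transl (- z) \<eta>) ms"
proof (induction ms arbitrary: \<eta>)
  case (Cons m ms)
  obtain x e where m: "m = (x, e)" by (cases m)
  have "c x (x + e) (transl (- z) \<eta>) = c (x + z) (x + z + e) \<eta>" if "e \<in> dirs"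
    using inv[OF nbr_add[OF that], of x "transl (- z) \<eta>" z]
    by (simp add: transl_def algebra_simps)
  moreover have "transl (- z) (swp \<eta> (x + z) (x + z + e)) = swp (transl (- z) \<eta>) x (x + e)"
    by (auto simp: transl_def swp_def fun_eq_iff algebra_simps)
  ultimately show ?case using Cons m by auto
qed simp

section \<open>Energy of a legal move\<close>

text \<open>Legality guarantees a rate of at least one, so the indicator of that event stands in for
  the rate; it never exceeds a nonnegative rate.\<close>

definition edge_energy ::
  "(('d::finite) site \<Rightarrow> 'd site \<Rightarrow> 'd config \<Rightarrow> real) \<Rightarrow> real \<Rightarrow> 'd site set \<Rightarrow>
   ('d config \<Rightarrow> real) \<Rightarrow> 'd site \<Rightarrow> 'd site \<Rightarrow> real" where
  "edge_energy c q S F a b =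
     bexpect q S (\<lambda>\<eta>. of_bool (1 \<le> c a b \<eta>) * (F (swp \<eta> a b) - F \<eta>)\<^sup>2)"

lemma sum_squared_le: "(u + v)\<^sup>2 \<le> 2 * u\<^sup>2 + 2 * (v::real)\<^sup>2"
proof -
  have "0 \<le> (u - v)\<^sup>2" by simp
  then show ?thesis by (simp add: power2_eq_square algebra_simps)
qed

text \<open>Cauchy-Schwarz with weights \<open>1\<close> and \<open>n\<close> on
  \<open>u + w\<close> and \<open>v\<close>. The resulting factor \<open>(n + 1) / n\<close> on
  \<open>v\<^sup>2\<close> makes a recursion in \<open>n\<close> telescope to linear growth.\<close>

lemma three_squares_le:
  fixes u v w :: real
  assumes "n > 0"
  shows "(u + v + w)\<^sup>2 \<le> (n + 1) * (2 * u\<^sup>2 + 2 * w\<^sup>2 + v\<^sup>2 / n)"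
proof -
  define y where "y = u + w"
  have "0 \<le> (n * y - v)\<^sup>2 / n" using assms by simp
  also have "\<dots> = (n + 1) * (y\<^sup>2 + v\<^sup>2 / n) - (y + v)\<^sup>2"
    using assms by (simp add: field_simps power2_eq_square)
  finally have "(y + v)\<^sup>2 \<le> (n + 1) * (y\<^sup>2 + v\<^sup>2 / n)" by simp
  also have "\<dots> \<le> (n + 1) * (2 * u\<^sup>2 + 2 * w\<^sup>2 + v\<^sup>2 / n)"
    using assms sum_squared_le[of u w] by (intro mult_left_mono) (auto simp: y_def)
  finally show ?thesis by (simp add: y_def algebra_simps)
qed

lemma edge_energy_nonneg: "0 \<le> q \<Longrightarrow> q \<le> 1 \<Longrightarrow> 0 \<le> edge_energy c q S F a b"
  unfolding edge_energy_def by (rule bexpect_nonneg) auto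

text \<open>The first step is split off with \<open>sum_squared_le\<close>, at a factor two per
  step, and invariance of the measure under its swap restarts the remaining move from equilibrium.
  The exponential constant is harmless because only moves of fixed length are estimated this
  way.\<close>

lemma legal_move_energy:
  assumes "0 \<le> q" "q \<le> 1" "sites_of ms \<subseteq> S"
  shows "bexpect q S (\<lambda>\<eta>. of_bool (legal c \<eta> ms) * (F (run \<eta> ms) - F \<eta>)\<^sup>2)
    \<le> 2 ^ length ms * (\<Sum>(x, e)\<leftarrow>ms. edge_energy c q S F x (x + e))"
  using assms(3)
proof (induction ms)
  case (Cons m ms)
  obtain x e where m: "m = (x, e)" by (cases m)
  let ?I = "\<lambda>\<eta>. of_bool (legal c \<eta> ms) * (F (run \<eta> ms) - F \<eta>)\<^sup>2"
  let ?J = "\<lambda>\<eta>. of_bool (1 \<le> c x (x + e) \<eta>) * (F (swp \<eta> x (x + e)) - F \<eta>)\<^sup>2"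
  let ?s = "\<Sum>(x, e)\<leftarrow>ms. edge_energy c q S F x (x + e)"
  have "bexpect q S (\<lambda>\<eta>. of_bool (legal c \<eta> (m # ms)) * (F (run \<eta> (m # ms)) - F \<eta>)\<^sup>2)
    \<le> bexpect q S (\<lambda>\<eta>. 2 * ?I (swp \<eta> x (x + e)) + 2 * ?J \<eta>)"
  proof (rule bexpect_mono[OF assms(1,2)])
    fix \<eta>
    show "of_bool (legal c \<eta> (m # ms)) * (F (run \<eta> (m # ms)) - F \<eta>)\<^sup>2
      \<le> 2 * ?I (swp \<eta> x (x + e)) + 2 * ?J \<eta>"
      using sum_squared_le[of "F (run (swp \<eta> x (x + e)) ms) - F (swp \<eta> x (x + e))"
          "F (swp \<eta> x (x + e)) - F \<eta>"]
      by (auto simp: m)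
  qed
  also have "\<dots> = 2 * bexpect q S ?I + 2 * edge_energy c q S F x (x + e)"
    unfolding bexpect_add bexpect_cmult edge_energy_def
    using Cons.prems m by (subst bexpect_swp[where g = ?I]) auto
  also have "\<dots> \<le> 2 * (2 ^ length ms * ?s) + 2 * (2 ^ length ms * edge_energy c q S F x (x + e))"
    using Cons m edge_energy_nonneg[OF assms(1,2), of c S F x "x + e"]
    by (intro add_mono mult_left_mono) (auto intro: mult_le_cancel_right1[THEN iffD2])
  finally show ?case by (simp add: m algebra_simps)
qed simp

section \<open>Carrying a particle along with the cluster\<close>

text \<open>The move \<open>A\<close> is an exchange followed by a translation: it pushes the cluster and the
  content of the site \<open>smul l e\<close> one step in direction \<open>e\<close>.  Conjugating with it turns the
  transposition of two sites at distance \<open>n\<close> into one of sites at distance \<open>n + 1\<close>.\<close>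

locale carrying =
  fixes c :: "('d::finite) site \<Rightarrow> 'd site \<Rightarrow> 'd config \<Rightarrow> real"
    and Cl :: "'d site set" and e :: "'d site" and l :: int and E A :: "'d move"
  assumes inv: "nbr x y \<Longrightarrow> c x y \<eta> = c (x + z) (y + z) (transl z \<eta>)"
    and legal_E: "\<eta> \<in> empty_on Cl \<Longrightarrow> legal c \<eta> E"
    and legal_A: "\<eta> \<in> empty_on Cl \<Longrightarrow> legal c \<eta> A"
    and mperm_E: "mperm E = transpos (smul l e) (smul (l + 1) e)"
    and mperm_A_Cl: "y \<in> Cl \<Longrightarrow> mperm A y = y + e"
    and mperm_A_near: "mperm A (smul l e) = smul (l + 1) e"
    and mperm_A_far: "m > l + 1 \<Longrightarrow> mperm A (smul m e) = smul m e"
    and axis_notin_Cl: "m \<ge> l \<Longrightarrow> smul m e \<notin> Cl"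
begin

definition cluster_at :: "'d site \<Rightarrow> 'd site set" where
  "cluster_at z = (\<lambda>y. y + z) ` Cl"

definition move_energy ::
  "real \<Rightarrow> 'd site set \<Rightarrow> ('d config \<Rightarrow> real) \<Rightarrow> 'd move \<Rightarrow> 'd site \<Rightarrow> real" where
  "move_energy q S F ms z = bexpect q S
     (\<lambda>\<eta>. of_bool (\<eta> \<in> empty_on (cluster_at z)) * (F (run \<eta> (shift z ms)) - F \<eta>)\<^sup>2)"

text \<open>No rate enters: for \<open>n > 1\<close> the exchange is not a step of the dynamics, and
  its cost is to be bounded through moves.\<close>

definition exchange_energy ::
  "real \<Rightarrow> 'd site set \<Rightarrow> ('d config \<Rightarrow> real) \<Rightarrow> nat \<Rightarrow> 'd site \<Rightarrow> real" where
  "exchange_energy q S F n z = bexpect q S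
     (\<lambda>\<eta>. of_bool (\<eta> \<in> empty_on (cluster_at z)) *
        (F (swp \<eta> (smul l e + z) (smul (l + int n) e + z)) - F \<eta>)\<^sup>2)"

lemma axis_notin_cluster_at: "m \<ge> l \<Longrightarrow> smul m e + z \<notin> cluster_at z"
  using axis_notin_Cl by (auto simp: cluster_at_def)

lemma empty_on_cluster_at: "\<eta> \<in> empty_on (cluster_at z) \<longleftrightarrow> transl (- z) \<eta> \<in> empty_on Cl"
  by (auto simp: empty_on_def cluster_at_def transl_def)

lemma move_energy_nonneg: "0 \<le> q \<Longrightarrow> q \<le> 1 \<Longrightarrow> 0 \<le> move_energy q S F ms z"
  unfolding move_energy_def by (rule bexpect_nonneg) auto

lemma move_energy_le:
  assumes "0 \<le> q" "q \<le> 1" "sites_of (shift z ms) \<subseteq> S"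
    and "\<And>\<eta>. \<eta> \<in> empty_on Cl \<Longrightarrow> legal c \<eta> ms"
  shows "move_energy q S F ms z
    \<le> 2 ^ length ms * (\<Sum>(x, u)\<leftarrow>ms. edge_energy c q S F (x + z) (x + z + u))"
proof -
  have "move_energy q S F ms z
    \<le> bexpect q S (\<lambda>\<eta>. of_bool (legal c \<eta> (shift z ms)) * (F (run \<eta> (shift z ms)) - F \<eta>)\<^sup>2)"
    unfolding move_energy_def
  proof (rule bexpect_mono[OF assms(1,2)])
    fix \<eta>
    have "legal c \<eta> (shift z ms)" if "\<eta> \<in> empty_on (cluster_at z)"
      using that assms(4) legal_shift[of c \<eta> z ms, OF inv] by (simp add: empty_on_cluster_at)
    then show "of_bool (\<eta> \<in> empty_on (cluster_at z)) * (F (run \<eta> (shift z ms)) - F \<eta>)\<^sup>2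
      \<le> of_bool (legal c \<eta> (shift z ms)) * (F (run \<eta> (shift z ms)) - F \<eta>)\<^sup>2"
      by auto
  qed
  also have "\<dots> \<le> 2 ^ length (shift z ms) *
      (\<Sum>(x, u)\<leftarrow>shift z ms. edge_energy c q S F x (x + u))"
    by (rule legal_move_energy[OF assms(1-3)])
  also have "\<dots> = 2 ^ length ms * (\<Sum>(x, u)\<leftarrow>ms. edge_energy c q S F (x + z) (x + z + u))"
    by (simp add: shift_def o_def split_def)
  finally show ?thesis .
qed

text \<open>\<open>E\<close> composes to exactly this transposition, so the shortest exchange is
  realised by a move.\<close>

lemma exchange_energy_one: "exchange_energy q S F 1 z = move_energy q S F E z"
proof -
  have "mperm (shift z E) = transpos (smul l e + z) (smul (l + 1) e + z)"
  proof
    fix y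
    show "mperm (shift z E) y = transpos (smul l e + z) (smul (l + 1) e + z) y"
      using mperm_shift[of z E "y - z"] by (auto simp: mperm_E transpos_def algebra_simps)
  qed
  then show ?thesis
    by (simp add: exchange_energy_def move_energy_def run_eq_swp)
qed

text \<open>The long swap is conjugated by \<open>A\<close>: push the cluster and the content of
  \<open>smul l e + z\<close> one step, perform the exchange of length \<open>n\<close> from there,
  and pull back. The costs are combined by \<open>three_squares_le\<close>.\<close>

lemma exchange_energy_Suc:
  assumes q: "0 \<le> q" "q \<le> 1" and n: "n \<ge> 1"
    and A: "sites_of (shift z A) \<subseteq> S"
    and p: "smul l e + z \<in> S" "smul (l + int (Suc n)) e + z \<in> S"
  shows "exchange_energy q S F (Suc n) z \<le>
    real (Suc n) * (4 * move_energy q S F A z + exchange_energy q S F n (z + e) / real n)"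
proof -
  let ?a = "smul l e + z" and ?b = "smul (l + int (Suc n)) e + z" and ?a' = "smul l e + (z + e)"
  let ?B = "\<lambda>\<eta>. run \<eta> (shift z A)"
  let ?G = "\<lambda>\<eta>. of_bool (\<eta> \<in> empty_on (cluster_at z)) * (F (?B \<eta>) - F \<eta>)\<^sup>2"
  let ?H = "\<lambda>\<eta>. of_bool (\<eta> \<in> empty_on (cluster_at (z + e))) * (F (swp \<eta> ?a' ?b) - F \<eta>)\<^sup>2"
  have b': "smul (l + int n) e + (z + e) = ?b" and a': "smul (l + 1) e + z = ?a'"
    by (auto simp: smul_def vec_eq_iff algebra_simps)
  \<comment> \<open>\<open>n \<ge> 1\<close> puts \<open>?b\<close> beyond \<open>?a'\<close>, so
    \<open>A\<close> leaves it in place while carrying \<open>?a\<close> to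
    \<open>?a'\<close>.\<close>
  have swp_B: "?B (swp \<eta> ?a ?b) = swp (?B \<eta>) ?a' ?b" for \<eta>
    unfolding run_swp mperm_shift mperm_A_near a' using n by (subst mperm_A_far) auto
  \<comment> \<open>Both exchanged sites lie off the cluster, so \<open>A\<close> may also be run
    from the swapped configuration; this pays for the way back.\<close>
  have emp: "swp \<eta> ?a ?b \<in> empty_on (cluster_at z) \<longleftrightarrow> \<eta> \<in> empty_on (cluster_at z)" for \<eta>
    by (intro swp_empty_on_iff axis_notin_cluster_at) auto
  have emp_B: "?B \<eta> \<in> empty_on (cluster_at (z + e))" if "\<eta> \<in> empty_on (cluster_at z)" for \<eta>
  proof -
    have "\<not> ?B \<eta> (y + (z + e))" if y: "y \<in> Cl" for y
    proof -
      have "y + (z + e) = mperm (shift z A) (y + z)"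
        using y by (simp add: mperm_shift mperm_A_Cl algebra_simps)
      moreover have "\<not> \<eta> (y + z)"
        using \<open>\<eta> \<in> empty_on (cluster_at z)\<close> y by (auto simp: empty_on_def cluster_at_def)
      ultimately show ?thesis by (simp add: run_mperm)
    qed
    then show ?thesis by (auto simp: empty_on_def cluster_at_def)
  qed
  have "exchange_energy q S F (Suc n) z \<le>
    bexpect q S (\<lambda>\<eta>. real (Suc n) * (2 * ?G (swp \<eta> ?a ?b) + 2 * ?G \<eta> + (1 / real n) * ?H (?B \<eta>)))"
    unfolding exchange_energy_def
  proof (rule bexpect_mono[OF q])
    fix \<eta>
    show "of_bool (\<eta> \<in> empty_on (cluster_at z)) * (F (swp \<eta> ?a ?b) - F \<eta>)\<^sup>2
      \<le> real (Suc n) * (2 * ?G (swp \<eta> ?a ?b) + 2 * ?G \<eta> + (1 / real n) * ?H (?B \<eta>))"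
    proof (cases "\<eta> \<in> empty_on (cluster_at z)")
      case True
      \<comment> \<open>\<open>w\<close> is the initial run of \<open>A\<close>, \<open>v\<close>
        the shorter exchange after it, and \<open>u\<close> the return along \<open>A\<close> to the
        swapped configuration.\<close>
      define u v w where "u = F (swp \<eta> ?a ?b) - F (?B (swp \<eta> ?a ?b))"
        and "v = F (?B (swp \<eta> ?a ?b)) - F (?B \<eta>)" and "w = F (?B \<eta>) - F \<eta>"
      have "?G (swp \<eta> ?a ?b) = u\<^sup>2"
        unfolding emp u_def using True by (simp add: power2_commute)
      moreover have "?G \<eta> = w\<^sup>2" using True by (simp add: w_def)
      moreover have "?H (?B \<eta>) = v\<^sup>2" unfolding v_def swp_B using emp_B[OF True] by simp
      moreover have "F (swp \<eta> ?a ?b) - F \<eta> = u + v + w" by (simp add: u_def v_def w_def)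
      moreover have "(u + v + w)\<^sup>2 \<le> real (Suc n) * (2 * u\<^sup>2 + 2 * w\<^sup>2 + (1 / real n) * v\<^sup>2)"
        using three_squares_le[of "real n" u v w] n by (simp add: add.commute)
      ultimately show ?thesis using True by (simp only: of_bool_eq mult_1 if_True)
    qed simp
  qed
  also have "\<dots> = real (Suc n) * (2 * bexpect q S ?G + 2 * bexpect q S ?G + (1 / real n) * bexpect q S ?H)"
    unfolding bexpect_add bexpect_cmult
    by (simp only: bexpect_run[OF A, where g = ?H] bexpect_swp[OF p, where g = ?G])
  also have "\<dots> = real (Suc n) * (4 * move_energy q S F A z + exchange_energy q S F n (z + e) / real n)"
    unfolding move_energy_def exchange_energy_def b' by simp
  finally show ?thesis .
qed

text \<open>Divided by \<open>n\<close>, the recursion of \<open>exchange_energy_Suc\<close>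
  telescopes: each step forward adds only the local cost at the current cluster position.\<close>

lemma exchange_energy_le:
  assumes q: "0 \<le> q" "q \<le> 1" and "n \<ge> 1"
    and "\<And>k. k < n \<Longrightarrow> sites_of (shift (z + smul (int k) e) A) \<subseteq> S"
    and "\<And>k. k \<le> n \<Longrightarrow> smul (l + int k) e + z \<in> S"
  shows "exchange_energy q S F n z \<le> real n * (\<Sum>k<n.
    4 * move_energy q S F A (z + smul (int k) e) + move_energy q S F E (z + smul (int k) e))"
  using assms(3-)
proof (induction n arbitrary: z rule: nat_induct_at_least)
  case base
  have "smul 0 e = 0" by (simp add: smul_def vec_eq_iff)
  then show ?case
    using exchange_energy_one move_energy_nonneg[OF q] by simp
next
  case (Suc n)
  let ?b = "\<lambda>z. 4 * move_energy q S F A z + move_energy q S F E z"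
  have sm: "z + e + smul (int k) e = z + smul (int (Suc k)) e"
    "smul (l + int k) e + (z + e) = smul (l + int (Suc k)) e + z" "z + smul (int 0) e = z" for k
    by (auto simp: smul_def vec_eq_iff algebra_simps)
  have IH: "exchange_energy q S F n (z + e) \<le> real n * (\<Sum>k<n. ?b (z + smul (int (Suc k)) e))"
    unfolding sm(1)[symmetric]
  proof (rule Suc.IH)
    show "sites_of (shift (z + e + smul (int k) e) A) \<subseteq> S" if "k < n" for k
      unfolding sm(1) using that by (intro Suc.prems(1)) simp
    show "smul (l + int k) e + (z + e) \<in> S" if "k \<le> n" for k
      unfolding sm(2) using that by (intro Suc.prems(2)) simp
  qed
  have "exchange_energy q S F (Suc n) z \<le>
    real (Suc n) * (4 * move_energy q S F A z + exchange_energy q S F n (z + e) / real n)"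
    using Suc.prems(1)[of 0] Suc.prems(2)[of 0] Suc.prems(2)[of "Suc n"] Suc.hyps sm(3)
    by (intro exchange_energy_Suc[OF q]) auto
  \<comment> \<open>The nonnegative \<open>E\<close> cost at \<open>z\<close> is added to give all
    summands the same form; the recursion itself brings it in only at the last position.\<close>
  also have "\<dots> \<le> real (Suc n) * (?b z + (\<Sum>k<n. ?b (z + smul (int (Suc k)) e)))"
    using IH Suc.hyps move_energy_nonneg[OF q, of S F E z]
    by (intro mult_left_mono add_mono) (auto simp: field_simps)
  also have "\<dots> = real (Suc n) * (\<Sum>k<Suc n. ?b (z + smul (int k) e))"
    unfolding sum.lessThan_Suc_shift sm(3) ..
  finally show ?case .
qed

end

section \<open>Reservoirs as exchanges with an unconstrained exterior\<close>

text \<open>Serves to extend \<open>f\<close> to the larger set: \<open>f (restr B \<eta>)\<close>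
  ignores all contents outside \<open>B\<close>.\<close>

definition restr :: "'a set \<Rightarrow> ('a \<Rightarrow> bool) \<Rightarrow> 'a \<Rightarrow> bool" where
  "restr B \<eta> = (\<lambda>x. \<eta> x \<and> x \<in> B)"

lemma restr_upd_outside: "a \<notin> B \<Longrightarrow> restr B (\<eta>(a := b)) = restr B \<eta>"
  by (auto simp: restr_def fun_eq_iff)

lemma restr_confs_on: "\<eta> \<in> confs_on B \<Longrightarrow> restr B \<eta> = \<eta>"
  by (auto simp: restr_def confs_on_def fun_eq_iff)

lemma bexpect_restr:
  assumes "finite S" "B \<subseteq> S"
  shows "bexpect q S (\<lambda>\<eta>. g (restr B \<eta>)) = bexpect q B g"
proof -
  have "bexpect q S (\<lambda>\<eta>. g (restr B \<eta>)) = bexpect q B (\<lambda>\<eta>. g (restr B \<eta>))"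
    by (rule bexpect_superset[OF assms]) (simp add: restr_upd_outside)
  also have "\<dots> = bexpect q B g"
    by (rule bexpect_cong) (simp add: restr_confs_on)
  finally show ?thesis .
qed

text \<open>At a boundary site of the box this is a reservoir summand of the Dirichlet form; summed
  over the whole box it is the quantity to be estimated.\<close>

definition flip_energy ::
  "real \<Rightarrow> ('d::finite) site set \<Rightarrow> ('d config \<Rightarrow> real) \<Rightarrow> 'd site \<Rightarrow> real" where
  "flip_energy q B f x = bexpect q B (\<lambda>\<eta>. res_rate q \<eta> x * (f (flp \<eta> x) - f \<eta>)\<^sup>2)"

lemma res_rate_eq: "res_rate q \<eta> x = (if \<eta> x then q else 1 - q)"
  by (simp add: res_rate_def)

lemma flip_energy_nonneg: "0 \<le> q \<Longrightarrow> q \<le> 1 \<Longrightarrow> 0 \<le> flip_energy q B f x"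
  unfolding flip_energy_def by (rule bexpect_nonneg) (auto simp: res_rate_eq)

text \<open>The rate \<open>res_rate q \<eta> x\<close> is the probability that an independent Bernoulli site differs
  from \<open>\<eta> x\<close>.\<close>

lemma bexpect_exchange_outside:
  assumes "finite S" "B \<subseteq> S" "x \<in> B" "w \<in> S" "w \<notin> B"
  shows "bexpect q S (\<lambda>\<eta>. (f (restr B (swp \<eta> x w)) - f (restr B \<eta>))\<^sup>2) = flip_energy q B f x"
proof -
  let ?H = "\<lambda>\<eta>. res_rate q \<eta> x * (f (flp \<eta> x) - f \<eta>)\<^sup>2"
  have "bexpect q S (\<lambda>\<eta>. (f (restr B (swp \<eta> x w)) - f (restr B \<eta>))\<^sup>2)
    = bexpect q S (\<lambda>\<eta>. ?H (restr B \<eta>))"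
  proof (rule bexpect_integrate_site[where a = w])
    fix \<eta> b
    have r: "restr B (\<eta>(w := v)) = restr B \<eta>" for v using assms by (simp add: restr_upd_outside)
    have s: "restr B (swp (\<eta>(w := v)) x w) = (restr B \<eta>)(x := v)" for v
      using assms by (auto simp: restr_def swp_def fun_eq_iff)
    have x: "restr B \<eta> x = \<eta> x" using assms by (simp add: restr_def)
    have t: "(restr B \<eta>)(x := \<eta> x) = restr B \<eta>" by (rule fun_upd_idem) (rule x)
    show "?H (restr B (\<eta>(w := b))) =
      q * (f (restr B (swp (\<eta>(w := False)) x w)) - f (restr B (\<eta>(w := False))))\<^sup>2
      + (1 - q) * (f (restr B (swp (\<eta>(w := True)) x w)) - f (restr B (\<eta>(w := True))))\<^sup>2"
      unfolding r s flp_def res_rate_eq x using t by (cases "\<eta> x") simp_all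
  qed (use assms in auto)
  also have "\<dots> = flip_energy q B f x"
    unfolding flip_energy_def by (rule bexpect_restr[OF assms(1,2)])
  finally show ?thesis .
qed

text \<open>The squared gradient is the same for both values at \<open>x\<close>, and the mean of
  the rate is \<open>q * (1 - q) + (1 - q) * q\<close>, whence the factor two.\<close>

lemma flip_energy_eq:
  assumes "finite B" "x \<in> B"
  shows "flip_energy q B f x = 2 * (q * (1 - q) * bexpect q B (\<lambda>\<eta>. (f (flp \<eta> x) - f \<eta>)\<^sup>2))"
proof -
  have "flip_energy q B f x = bexpect q B (\<lambda>\<eta>. 2 * (q * (1 - q)) * (f (flp \<eta> x) - f \<eta>)\<^sup>2)"
    unfolding flip_energy_def
  proof (rule bexpect_integrate_site[OF assms])
    fix \<eta> b
    have "(f (flp (\<eta>(x := v)) x) - f (\<eta>(x := v)))\<^sup>2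
        = (f (\<eta>(x := True)) - f (\<eta>(x := False)))\<^sup>2" for v
      by (cases v) (simp_all add: flp_def power2_commute)
    then show "2 * (q * (1 - q)) * (f (flp (\<eta>(x := b)) x) - f (\<eta>(x := b)))\<^sup>2 =
      q * (res_rate q (\<eta>(x := False)) x * (f (flp (\<eta>(x := False)) x) - f (\<eta>(x := False)))\<^sup>2)
      + (1 - q) * (res_rate q (\<eta>(x := True)) x * (f (flp (\<eta>(x := True)) x) - f (\<eta>(x := True)))\<^sup>2)"
      by (simp add: res_rate_eq algebra_simps)
  qed
  then show ?thesis by (simp add: bexpect_cmult)
qed

section \<open>Finiteness of the site sets\<close>

lemma finite_bounded_sites: "finite X \<Longrightarrow> finite {z :: ('d::finite) site. \<forall>i. z$i \<in> X}"
proof -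
  assume "finite X"
  have "{z :: 'd site. \<forall>i. z$i \<in> X} \<subseteq> vec_lambda ` (\<Pi>\<^sub>E i\<in>UNIV. X)"
  proof
    fix z :: "'d site" assume "z \<in> {z. \<forall>i. z$i \<in> X}"
    then have "z = vec_lambda (\<lambda>i. z$i)" "(\<lambda>i. z$i) \<in> (\<Pi>\<^sub>E i\<in>UNIV. X)" by auto
    then show "z \<in> vec_lambda ` (\<Pi>\<^sub>E i\<in>UNIV. X)" by blast
  qed
  then show ?thesis
    using \<open>finite X\<close> by (meson finite_PiE finite_imageI finite_subset finite)
qed

lemma finite_box: "finite (box L)"
  using finite_bounded_sites[of "{1..int L}"] by (simp add: box_def)

lemma finite_cube_0: "finite (cube 0 M)"
  by (rule finite_subset[OF _ finite_bounded_sites[of "{-M..M}"]])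
    (auto simp: cube_def abs_le_iff minus_le_iff)

lemma cube_mono: "R \<le> R' \<Longrightarrow> cube x R \<subseteq> cube x R'"
  by (auto simp: cube_def intro: order_trans)

lemma bdry_subset: "bdry L \<subseteq> box L"
  by (auto simp: bdry_def)

section \<open>Variance and Dirichlet form as sums over sites and edges\<close>

lemma var_le_flip_energy:
  assumes "0 \<le> q" "q \<le> 1"
  shows "2 * var q L f \<le> (\<Sum>x\<in>box L. flip_energy q (box L) f x)"
proof -
  have "var q L f \<le> (\<Sum>x\<in>box L. q * (1 - q) * bexpect q (box L) (\<lambda>\<eta>. (f (flp \<eta> x) - f \<eta>)\<^sup>2))"
    unfolding var_def expect_eq_bexpect flp_def
    by (rule bexpect_variance_le[OF finite_box assms])
  moreover have "(\<Sum>x\<in>box L. flip_energy q (box L) f x)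
    = 2 * (\<Sum>x\<in>box L. q * (1 - q) * bexpect q (box L) (\<lambda>\<eta>. (f (flp \<eta> x) - f \<eta>)\<^sup>2))"
    unfolding sum_distrib_left by (rule sum.cong) (simp_all add: flip_energy_eq finite_box)
  ultimately show ?thesis by linarith
qed

definition bulk_energy ::
  "(('d::finite) site \<Rightarrow> 'd site \<Rightarrow> 'd config \<Rightarrow> real) \<Rightarrow> real \<Rightarrow> 'd site set \<Rightarrow>
   ('d config \<Rightarrow> real) \<Rightarrow> 'd site \<Rightarrow> 'd site \<Rightarrow> real" where
  "bulk_energy c q B f a b = bexpect q B (\<lambda>\<eta>. c a b \<eta> * (f (swp \<eta> a b) - f \<eta>)\<^sup>2)"

lemma dirichlet_r_eq:
  "dirichlet_r c q L f = (\<Sum>x\<in>box L. \<Sum>y\<in>{y\<in>box L. nbr x y}. bulk_energy c q (box L) f x y)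
    + (\<Sum>x\<in>bdry L. flip_energy q (box L) f x)"
  by (simp add: dirichlet_r_def expect_eq_bexpect bexpect_sum bulk_energy_def flip_energy_def)

text \<open>A translation is injective, so each site of \<open>T\<close> is charged at most once;
  summing over all start sites then costs no power of the volume.\<close>

lemma sum_shift_le:
  fixes \<phi> :: "'a::group_add \<Rightarrow> real"
  assumes "finite X" "finite T" "\<And>a. 0 \<le> \<phi> a"
  shows "(\<Sum>x\<in>X. if x + v \<in> T then \<phi> (x + v) else 0) \<le> sum \<phi> T"
proof -
  have "(\<Sum>x\<in>X. if x + v \<in> T then \<phi> (x + v) else 0)
      = (\<Sum>a\<in>(\<lambda>x. x + v) ` X. if a \<in> T then \<phi> a else 0)"
    by (subst sum.reindex) (auto simp: inj_on_def)
  also have "\<dots> = sum \<phi> ((\<lambda>x. x + v) ` X \<inter> T)"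
    using assms by (subst sum.inter_restrict) auto
  also have "\<dots> \<le> sum \<phi> T"
    using assms by (intro sum_mono2) auto
  finally show ?thesis .
qed

locale box_rates =
  fixes c :: "('d::finite) site \<Rightarrow> 'd site \<Rightarrow> 'd config \<Rightarrow> real" and q :: real
  assumes q: "0 \<le> q" "q \<le> 1"
    and c_nonneg: "nbr x y \<Longrightarrow> 0 \<le> c x y \<eta>"
    and c_antimono: "nbr x y \<Longrightarrow> (\<And>z. \<eta> z \<Longrightarrow> \<eta>' z) \<Longrightarrow> c x y \<eta>' \<le> c x y \<eta>"
begin

lemma bulk_energy_nonneg: "nbr a b \<Longrightarrow> 0 \<le> bulk_energy c q B f a b"
  unfolding bulk_energy_def using q c_nonneg by (intro bexpect_nonneg) auto

text \<open>Edges inside the box are controlled by monotonicity, edges across its border by exchange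
  with an independent exterior site, and edges outside are invisible to the extended
  function.\<close>

lemma edge_energy_restr_le:
  assumes "finite S" "box L \<subseteq> S" "a \<in> S" "b \<in> S" "nbr a b"
  shows "edge_energy c q S (\<lambda>\<eta>. f (restr (box L) \<eta>)) a b \<le>
    (if a \<in> box L \<and> b \<in> box L then bulk_energy c q (box L) f a b else 0)
    + (if a \<in> box L \<and> b \<notin> box L then flip_energy q (box L) f a else 0)
    + (if a \<notin> box L \<and> b \<in> box L then flip_energy q (box L) f b else 0)"
proof -
  let ?B = "box L" and ?F = "\<lambda>\<eta>. f (restr (box L) \<eta>)"
  have le: "edge_energy c q S ?F a b \<le> bexpect q S (\<lambda>\<eta>. (?F (swp \<eta> a b) - ?F \<eta>)\<^sup>2)"
    unfolding edge_energy_def by (rule bexpect_mono[OF q]) auto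
  consider "a \<in> ?B" "b \<in> ?B" | "a \<in> ?B" "b \<notin> ?B" | "a \<notin> ?B" "b \<in> ?B" | "a \<notin> ?B" "b \<notin> ?B"
    by blast
  then show ?thesis
  proof cases
    case 1
    have "edge_energy c q S ?F a b \<le> bexpect q S
      (\<lambda>\<eta>. c a b (restr ?B \<eta>) * (f (swp (restr ?B \<eta>) a b) - f (restr ?B \<eta>))\<^sup>2)"
      unfolding edge_energy_def
    proof (rule bexpect_mono[OF q])
      fix \<eta>
      have "restr ?B (swp \<eta> a b) = swp (restr ?B \<eta>) a b"
        using 1 by (auto simp: restr_def swp_def fun_eq_iff)
      \<comment> \<open>Emptying the exterior can only raise the rate, so where the indicator is one
        the rate with empty boundary is at least one.\<close>
      moreover have "c a b \<eta> \<le> c a b (restr ?B \<eta>)"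
        by (rule c_antimono[OF assms(5)]) (simp add: restr_def)
      then have "of_bool (1 \<le> c a b \<eta>) \<le> c a b (restr ?B \<eta>)"
        using c_nonneg[OF assms(5)] by auto
      ultimately show "of_bool (1 \<le> c a b \<eta>) * (?F (swp \<eta> a b) - ?F \<eta>)\<^sup>2
        \<le> c a b (restr ?B \<eta>) * (f (swp (restr ?B \<eta>) a b) - f (restr ?B \<eta>))\<^sup>2"
        by (simp only: mult_right_mono zero_le_power2)
    qed
    also have "\<dots> = bulk_energy c q ?B f a b"
      unfolding bulk_energy_def by (rule bexpect_restr[OF assms(1,2)])
    finally show ?thesis using 1 by simp
  next
    case 2
    then show ?thesis using le bexpect_exchange_outside[OF assms(1,2), of a b q f] assms by simp
  next
    case 3
    then show ?thesis
      using le bexpect_exchange_outside[OF assms(1,2), of b a q f] assms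
      by (simp add: swp_commute[of _ a b])
  next
    case 4
    then have "restr ?B (swp \<eta> a b) = restr ?B \<eta>" for \<eta>
      by (auto simp: restr_def swp_def fun_eq_iff)
    then show ?thesis using 4 by (simp add: edge_energy_def)
  qed
qed

lemma dirichlet_r_nonneg: "0 \<le> dirichlet_r c q L f"
  unfolding dirichlet_r_eq
  by (intro add_nonneg_nonneg sum_nonneg flip_energy_nonneg q) (auto simp: bulk_energy_nonneg)

text \<open>For fixed \<open>v\<close> and \<open>u\<close>, distinct \<open>x\<close> use distinct
  translates of one edge. A bulk edge is hit at most once and a boundary site at most twice, as the
  inner end of an edge leaving or entering the box.\<close>

lemma sum_edge_energy_le:
  assumes "finite S" "box L \<subseteq> S" "u \<in> dirs"
    and S: "\<And>x. x \<in> box L \<Longrightarrow> x + v \<in> S \<and> x + v + u \<in> S"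
  shows "(\<Sum>x\<in>box L. edge_energy c q S (\<lambda>\<eta>. f (restr (box L) \<eta>)) (x + v) (x + v + u))
    \<le> 2 * dirichlet_r c q L f"
proof -
  let ?B = "box L :: 'd site set"
  let ?R = "flip_energy q ?B f"
  let ?D = "bulk_energy c q ?B f"
  let ?T = "{a \<in> ?B. a + u \<in> ?B}"
  have fin: "finite ?B" "finite ?T" "finite (bdry L)"
    by (auto intro: finite_subset[OF bdry_subset] simp: finite_box)
  have pw: "edge_energy c q S (\<lambda>\<eta>. f (restr ?B \<eta>)) (x + v) (x + v + u)
    \<le> (if x + v \<in> ?T then ?D (x + v) (x + v + u) else 0)
      + (if x + v \<in> bdry L then ?R (x + v) else 0)
      + (if x + (v + u) \<in> bdry L then ?R (x + (v + u)) else 0)" if "x \<in> ?B" for x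
  proof -
    have n: "nbr (x + v) (x + v + u)" "nbr (x + v + u) (x + v)"
      using assms(3) by (auto simp: nbr_def neg_dirs)
    then have b: "x + v \<in> ?B \<Longrightarrow> x + v + u \<notin> ?B \<Longrightarrow> x + v \<in> bdry L"
      "x + v + u \<in> ?B \<Longrightarrow> x + v \<notin> ?B \<Longrightarrow> x + (v + u) \<in> bdry L"
      by (auto simp: bdry_def add.assoc)
    have R: "0 \<le> ?R a" for a by (rule flip_energy_nonneg[OF q])
    show ?thesis
      using edge_energy_restr_le[OF assms(1,2) _ _ n(1), of f] S[OF that] b
        R[of "x + v"] R[of "x + (v + u)"]
      by (auto simp: add.assoc split: if_splits)
  qed
  have "(\<Sum>x\<in>?B. edge_energy c q S (\<lambda>\<eta>. f (restr ?B \<eta>)) (x + v) (x + v + u))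
    \<le> (\<Sum>x\<in>?B. if x + v \<in> ?T then ?D (x + v) (x + v + u) else 0)
      + (\<Sum>x\<in>?B. if x + v \<in> bdry L then ?R (x + v) else 0)
      + (\<Sum>x\<in>?B. if x + (v + u) \<in> bdry L then ?R (x + (v + u)) else 0)"
    unfolding sum.distrib[symmetric] by (rule sum_mono) (rule pw)
  also have "\<dots> \<le> (\<Sum>a\<in>?T. ?D a (a + u)) + sum ?R (bdry L) + sum ?R (bdry L)"
    by (intro add_mono sum_shift_le fin sum_shift_le[where \<phi> = "\<lambda>a. ?D a (a + u)"]
        flip_energy_nonneg q bulk_energy_nonneg nbr_add assms)
  also have "(\<Sum>a\<in>?T. ?D a (a + u)) \<le> (\<Sum>a\<in>?T. \<Sum>y\<in>{y\<in>?B. nbr a y}. ?D a y)"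
  proof (rule sum_mono)
    fix a assume "a \<in> ?T"
    then show "?D a (a + u) \<le> (\<Sum>y\<in>{y\<in>?B. nbr a y}. ?D a y)"
      using fin assms(3) bulk_energy_nonneg nbr_add
      by (intro member_le_sum[where f = "?D a"]) auto
  qed
  also have "\<dots> \<le> (\<Sum>a\<in>?B. \<Sum>y\<in>{y\<in>?B. nbr a y}. ?D a y)"
    using fin bulk_energy_nonneg by (intro sum_mono2 sum_nonneg) auto
  finally have "(\<Sum>x\<in>?B. edge_energy c q S (\<lambda>\<eta>. f (restr ?B \<eta>)) (x + v) (x + v + u))
    \<le> (\<Sum>a\<in>?B. \<Sum>y\<in>{y\<in>?B. nbr a y}. ?D a y) + sum ?R (bdry L) + sum ?R (bdry L)" by simp
  moreover have "0 \<le> (\<Sum>a\<in>?B. \<Sum>y\<in>{y\<in>?B. nbr a y}. ?D a y)"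
    using bulk_energy_nonneg by (intro sum_nonneg) auto
  ultimately show ?thesis by (simp add: dirichlet_r_eq)
qed

end

lemma sum_sum_list_le:
  fixes h :: "'a \<Rightarrow> 'b \<Rightarrow> real"
  assumes "\<And>m. m \<in> set ms \<Longrightarrow> (\<Sum>x\<in>X. h x m) \<le> K"
  shows "(\<Sum>x\<in>X. \<Sum>m\<leftarrow>ms. h x m) \<le> real (length ms) * K"
  using assms
proof (induction ms)
  case (Cons m ms)
  then have "(\<Sum>x\<in>X. h x m) \<le> K" "(\<Sum>x\<in>X. \<Sum>m\<leftarrow>ms. h x m) \<le> real (length ms) * K" by auto
  then show ?case by (simp add: sum.distrib algebra_simps)
qed simp

section \<open>Summation over the box and the variance bound\<close>

locale carrying_in_box = carrying c Cl e l E A + box_rates c q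
  for c :: "('d::finite) site \<Rightarrow> 'd site \<Rightarrow> 'd config \<Rightarrow> real" and Cl e l E A q
begin

lemma sum_move_energy_le:
  assumes "finite S" "box L \<subseteq> S"
    and S: "\<And>x. x \<in> box L \<Longrightarrow> sites_of (shift (x + v) ms) \<subseteq> S"
    and leg: "\<And>\<eta>. \<eta> \<in> empty_on Cl \<Longrightarrow> legal c \<eta> ms"
  shows "(\<Sum>x\<in>box L. move_energy q S (\<lambda>\<eta>. f (restr (box L) \<eta>)) ms (x + v))
    \<le> 2 ^ length ms * (real (length ms) * (2 * dirichlet_r c q L f))"
proof -
  let ?e = "edge_energy c q S (\<lambda>\<eta>. f (restr (box L) \<eta>))"
  have "(\<Sum>x\<in>box L. move_energy q S (\<lambda>\<eta>. f (restr (box L) \<eta>)) ms (x + v))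
    \<le> (\<Sum>x\<in>box L. 2 ^ length ms * (\<Sum>(y, u)\<leftarrow>ms. ?e (y + (x + v)) (y + (x + v) + u)))"
    using S leg by (intro sum_mono move_energy_le q) auto
  also have "\<dots> = 2 ^ length ms *
      (\<Sum>x\<in>box L. \<Sum>m\<leftarrow>ms. case m of (y, u) \<Rightarrow> ?e (y + (x + v)) (y + (x + v) + u))"
    by (simp add: sum_distrib_left)
  also have "\<dots> \<le> 2 ^ length ms * (real (length ms) * (2 * dirichlet_r c q L f))"
  proof (intro mult_left_mono sum_sum_list_le)
    fix m assume m: "m \<in> set ms"
    obtain y u where yu: "m = (y, u)" by (cases m)
    \<comment> \<open>The all-empty configuration has an empty cluster, so the move is legal from it
      and its steps have directions in \<open>dirs\<close>.\<close>
    have u: "u \<in> dirs"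
      using legal_dirs[OF leg, of "\<lambda>_. False"] m yu by (auto simp: empty_on_def)
    have "x + (y + v) \<in> S \<and> x + (y + v) + u \<in> S" if "x \<in> box L" for x
    proof -
      have "y \<in> sites_of ms" "y + u \<in> sites_of ms" using m yu by (auto simp: sites_of_def)
      then have "y + (x + v) \<in> S" "y + u + (x + v) \<in> S"
        using S[OF that] by (auto simp: sites_of_shift)
      then show ?thesis by (simp add: algebra_simps)
    qed
    from sum_edge_energy_le[OF assms(1,2) u this, of f]
    show "(\<Sum>x\<in>box L. case m of (y, u) \<Rightarrow> ?e (y + (x + v)) (y + (x + v) + u)) \<le> 2 * dirichlet_r c q L f"
      by (simp add: yu algebra_simps)
  qed simp
  finally show ?thesis .
qed

text \<open>One factor \<open>L\<close> is the prefactor in \<open>exchange_energy_le\<close>; the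
  other counts the \<open>L\<close> cluster positions, each costing a fixed multiple of the
  Dirichlet form once summed over the box.\<close>

lemma variance_bound:
  assumes l: "l \<ge> 0" and e: "e = unitv i 1" and L: "L \<ge> 1"
    and Cl: "Cl \<subseteq> cube 0 l"
    and sites: "sites_of E \<subseteq> cube 0 (l + 1)" "sites_of A \<subseteq> cube 0 (l + 1)"
  shows "2 * (q ^ card Cl * var q L f) \<le> (real L)\<^sup>2 *
    ((4 * (2 ^ length A * real (length A)) + 2 ^ length E * real (length E)) * (2 * dirichlet_r c q L f))"
proof -
  let ?B = "box L :: 'd site set"
  let ?F = "\<lambda>\<eta>. f (restr ?B \<eta>)"
  let ?D = "dirichlet_r c q L f"
  \<comment> \<open>The coordinates of \<open>x\<close>, of \<open>v k\<close> and of the sites of a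
    move are at most \<open>L\<close>, \<open>L + l\<close> and \<open>l + 1\<close> in modulus; the
    radius is their sum.\<close>
  define S :: "'d site set" where "S = cube 0 (2 * int L + 2 * l + 1)"
  \<comment> \<open>After \<open>k\<close> steps towards \<open>x\<close> the cluster sits at \<open>x + v k\<close>.\<close>
  define v where "v k = smul (int k) e - smul (int L + l) e" for k
  have fin: "finite S" by (simp add: S_def finite_cube_0)
  have e_i: "e $ i = 1" and e_le: "\<bar>e $ j\<bar> \<le> 1" for j by (auto simp: e unitv_def)
  have x_le: "\<bar>x $ j\<bar> \<le> int L" if "x \<in> ?B" for x j
    using that by (auto simp: box_def abs_le_iff) (smt (verit))
  have smul_le: "\<bar>smul m e $ j\<bar> \<le> \<bar>m\<bar>" for m j
    using mult_left_mono[OF e_le[of j], of "\<bar>m\<bar>"] by (simp add: smul_def abs_mult)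
  have out: "x \<notin> ?B" if "x $ i \<le> 0" for x
  proof
    assume "x \<in> ?B"
    then have "1 \<le> x $ i" by (simp add: box_def)
    then show False using that by simp
  qed
  have B_S: "?B \<subseteq> S"
  proof
    fix x assume "x \<in> ?B"
    then have "\<bar>x $ j\<bar> \<le> 2 * int L + 2 * l + 1" for j using x_le[of x j] l by linarith
    then show "x \<in> S" by (simp add: S_def cube_def)
  qed
  have in_S: "y + (x + v k) \<in> S" if "x \<in> ?B" "k \<le> L" "y \<in> cube 0 (l + 1)" for x y k
  proof -
    have "\<bar>(y + (x + v k)) $ j\<bar> \<le> 2 * int L + 2 * l + 1" for j
    proof -
      have "v k = smul (int k - (int L + l)) e"
        by (simp add: v_def smul_def vec_eq_iff algebra_simps)
      then have "\<bar>v k $ j\<bar> \<le> int L + l" using smul_le[of "int k - (int L + l)" j] that(2) l by simp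
      moreover have "\<bar>y $ j\<bar> \<le> l + 1" using that(3) by (simp add: cube_def)
      ultimately show ?thesis using x_le[OF that(1), of j] by simp
    qed
    then show ?thesis by (simp add: S_def cube_def)
  qed
  have sh: "sites_of (shift (x + v k) ms) \<subseteq> S"
    if "x \<in> ?B" "k \<le> L" "sites_of ms \<subseteq> cube 0 (l + 1)" for x k ms
    using that in_S by (auto simp: sites_of_shift)
  have v_add: "x + v 0 + smul (int k) e = x + v k" for x k
    by (simp add: v_def smul_def vec_eq_iff)
  \<comment> \<open>The path begins \<open>L\<close> steps behind \<open>x\<close> at
    \<open>k = 0\<close> and reaches \<open>x\<close> at \<open>k = L\<close>.\<close>
  have path: "smul (l + int k) e + (x + v 0) = x + smul (int k - int L) e" for x k
    by (simp add: v_def smul_def vec_eq_iff algebra_simps)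
  have path_S: "smul (l + int k) e + (x + v 0) \<in> S" if "x \<in> ?B" "k \<le> L" for x k
  proof -
    have "\<bar>(x + smul (int k - int L) e) $ j\<bar> \<le> 2 * int L + 2 * l + 1" for j
      using x_le[OF that(1), of j] smul_le[of "int k - int L" j] that(2) l by simp
    then show ?thesis unfolding path by (simp add: S_def cube_def)
  qed

  \<comment> \<open>The cluster avoids both the box and the partner site \<open>?w\<close>, so its
    emptiness factors out; what remains is an exchange of \<open>x\<close> with an exterior site,
    which acts as a flip.\<close>
  have exch: "exchange_energy q S ?F L (x + v 0) = q ^ card Cl * flip_energy q ?B f x"
    if x: "x \<in> ?B" for x
  proof -
    let ?w = "smul l e + (x + v 0)"
    let ?C = "cluster_at (x + v 0)"
    let ?G = "\<lambda>\<eta>. (?F (swp \<eta> x ?w) - ?F \<eta>)\<^sup>2"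
    have xL: "x $ i \<le> int L" using x by (simp add: box_def)
    have w_eq: "?w = x + smul (- int L) e" using path[of 0 x] by simp
    have "?w $ i \<le> 0" unfolding w_eq using xL by (simp add: smul_def e_i)
    then have w: "?w \<notin> ?B" by (rule out)
    have w_C: "?w \<notin> ?C" by (rule axis_notin_cluster_at) simp
    have C_B: "a \<notin> ?B" if "a \<in> ?C" for a
    proof -
      obtain y where y: "y \<in> Cl" "a = y + (x + v 0)" using \<open>a \<in> ?C\<close> by (auto simp: cluster_at_def)
      have "\<bar>y $ i\<bar> \<le> l" using y Cl by (auto simp: cube_def)
      \<comment> \<open>The offset \<open>L + l\<close> in \<open>v 0\<close> absorbs the cluster
        radius \<open>l\<close>, so the whole cluster stays at nonpositive coordinates.\<close>
      then have "a $ i \<le> 0" using xL by (simp add: y(2) v_def smul_def e_i)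
      then show ?thesis by (rule out)
    qed
    have C_S: "?C \<subseteq> S"
    proof -
      have "Cl \<subseteq> cube 0 (l + 1)" using Cl cube_mono[of l "l + 1" 0] by auto
      then show ?thesis using in_S[OF x, of 0] by (auto simp: cluster_at_def)
    qed
    have card: "card ?C = card Cl"
      unfolding cluster_at_def by (rule card_image) (simp add: inj_on_def)
    have "exchange_energy q S ?F L (x + v 0) = bexpect q S (\<lambda>\<eta>. of_bool (\<forall>a\<in>?C. \<not> \<eta> a) * ?G \<eta>)"
    proof -
      have x_eq: "smul (l + int L) e + (x + v 0) = x"
        unfolding path by (simp add: smul_def vec_eq_iff)
      show ?thesis
        unfolding exchange_energy_def x_eq empty_on_def mem_Collect_eq swp_commute[of _ x] ..
    qed
    also have "\<dots> = q ^ card ?C * bexpect q S ?G"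
    proof (rule bexpect_all_empty[OF fin C_S])
      fix \<eta> a b assume a: "a \<in> ?C"
      then have ne: "a \<noteq> x" "a \<noteq> ?w" "a \<notin> ?B" using C_B x w_C by auto
      show "?G (\<eta>(a := b)) = ?G \<eta>"
        unfolding swp_upd[OF ne(1,2)] restr_upd_outside[OF ne(3)] ..
    qed
    also have "bexpect q S ?G = flip_energy q ?B f x"
      using w path_S[OF x, of 0] by (intro bexpect_exchange_outside[OF fin B_S x]) auto
    finally show ?thesis by (simp add: card)
  qed

  let ?m = "move_energy q S ?F"
  let ?N = "\<lambda>ms. 2 ^ length ms * (real (length ms) * (2 * ?D))"
  have "2 * (q ^ card Cl * var q L f) \<le> q ^ card Cl * (\<Sum>x\<in>?B. flip_energy q ?B f x)"
    using mult_left_mono[OF var_le_flip_energy[OF q, of L f], of "q ^ card Cl"] q by simp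
  also have "\<dots> = (\<Sum>x\<in>?B. exchange_energy q S ?F L (x + v 0))"
    by (simp add: exch sum_distrib_left)
  also have "\<dots> \<le> (\<Sum>x\<in>?B. real L * (\<Sum>k<L. 4 * ?m A (x + v k) + ?m E (x + v k)))"
  proof (rule sum_mono)
    fix x assume x: "x \<in> ?B"
    show "exchange_energy q S ?F L (x + v 0) \<le> real L * (\<Sum>k<L. 4 * ?m A (x + v k) + ?m E (x + v k))"
    proof (rule exchange_energy_le[OF q L, of "x + v 0" S ?F, unfolded v_add])
      show "sites_of (shift (x + v k) A) \<subseteq> S" if "k < L" for k
        using sh[OF x _ sites(2)] that by simp
      show "smul (l + int k) e + (x + v 0) \<in> S" if "k \<le> L" for k
        by (rule path_S[OF x that])
    qed
  qed
  \<comment> \<open>For fixed \<open>k\<close> the sum over \<open>x\<close> runs over translates of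
    one move, so it is taken first.\<close>
  also have "\<dots> = real L * (\<Sum>k<L. 4 * (\<Sum>x\<in>?B. ?m A (x + v k)) + (\<Sum>x\<in>?B. ?m E (x + v k)))"
    unfolding sum_distrib_left[symmetric] sum.swap[of _ ?B] sum.distrib ..
  also have "\<dots> \<le> real L * (\<Sum>k<L. 4 * ?N A + ?N E)"
    using sh sites legal_A legal_E
    by (intro mult_left_mono sum_mono add_mono sum_move_energy_le[OF fin B_S]) auto
  also have "\<dots> = (real L)\<^sup>2 * ((4 * (2 ^ length A * real (length A))
      + 2 ^ length E * real (length E)) * (2 * ?D))"
    by (simp add: power2_eq_square algebra_simps)
  finally show ?thesis .
qed

end

section \<open>Construction of the carrying move\<close>

text \<open>\<open>E\<close> first brings the content of \<open>smul (int l) e\<close> to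
  \<open>smul (int l + 1) e\<close>; \<open>T\<close> then advances the cluster and, staying in the
  cube, does not touch that site.\<close>

lemma carrying_append:
  fixes c :: "('d::finite) site \<Rightarrow> 'd site \<Rightarrow> 'd config \<Rightarrow> real"
  assumes inv: "\<And>x y z \<eta>. nbr x y \<Longrightarrow> c x y \<eta> = c (x + z) (y + z) (transl z \<eta>)"
    and E: "exchange_move c Cl e l E" and T: "translation_move c Cl e l T" and e: "e = unitv i 1"
  shows "carrying c Cl e (int l) E (E @ T)" and "Cl \<subseteq> cube 0 (int l)"
    and "sites_of E \<subseteq> cube 0 (int l + 1)" "sites_of (E @ T) \<subseteq> cube 0 (int l + 1)"
proof -
  let ?P = "\<lambda>m. smul m e"
  have e_i: "e $ i = 1" by (simp add: e unitv_def)
  then have P_i: "?P m $ i = m" for m by (simp add: smul_def)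
  have P_add: "?P m + e = ?P (m + 1)" for m by (simp add: smul_def vec_eq_iff algebra_simps)
  have T_sites: "sites_of T \<subseteq> cube 0 (int l)" and T_Cl: "\<And>y. y \<in> Cl \<Longrightarrow> mperm T y = y + e"
    and T_legal: "\<And>\<eta>. \<eta> \<in> empty_on Cl \<Longrightarrow> legal c \<eta> T"
    using T by (auto simp: translation_move_def)
  have E_sites: "sites_of E \<subseteq> cube 0 (int l) \<union> {?P (int l + 1)}"
    and E_perm: "mperm E = transpos (?P (int l)) (?P (int l + 1))"
    and E_legal: "\<And>\<eta>. \<eta> \<in> empty_on Cl \<Longrightarrow> legal c \<eta> E"
    using E by (auto simp: exchange_move_def)
  have "?P m \<notin> cube 0 (int l)" if "m > int l" for m
  proof
    assume "?P m \<in> cube 0 (int l)"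
    then have "\<bar>?P m $ i - 0 $ i\<bar> \<le> int l" unfolding cube_def by blast
    then show False using that by (simp add: P_i)
  qed
  then have T_far: "mperm T (?P m) = ?P m" if "m > int l" for m
    using that T_sites by (intro mperm_outside) auto
  have e0: "y + e \<noteq> y" for y using e_i by auto
  \<comment> \<open>\<open>T\<close> displaces every cluster site by the nonzero vector
    \<open>e\<close>, whereas a site it does not visit stays fixed.\<close>
  show Cl_cube: "Cl \<subseteq> cube 0 (int l)"
    using T_Cl e0 T_sites mperm_outside[of _ T] by fastforce
  \<comment> \<open>A cluster site \<open>?P m\<close> would be sent to \<open>?P (m + 1)\<close>,
    which \<open>T\<close> fixes as it lies outside the cube; injectivity of the permutation forbids
    this.\<close>
  have axis: "?P m \<notin> Cl" if "m \<ge> int l" for m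
  proof
    assume "?P m \<in> Cl"
    then have "mperm T (?P m) = mperm T (?P (m + 1))"
      using T_Cl[of "?P m"] T_far[of "m + 1"] that by (simp add: P_add)
    then have "?P m = ?P (m + 1)" using bij_mperm[of T] by (simp add: bij_def inj_eq)
    then show False using P_i by (metis add_cancel_left_right zero_neq_one)
  qed
  have P_inj: "?P m = ?P m' \<longleftrightarrow> m = m'" for m m' using P_i by metis
  show "carrying c Cl e (int l) E (E @ T)"
  proof
    fix \<eta> assume "\<eta> \<in> empty_on Cl"
    moreover from this have "run \<eta> E \<in> empty_on Cl"
      unfolding run_eq_swp[OF E_perm] by (subst swp_empty_on_iff) (auto simp: axis)
    ultimately show "legal c \<eta> (E @ T)" by (simp add: legal_append E_legal T_legal)
  next
    fix y assume "y \<in> Cl"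
    then show "mperm (E @ T) y = y + e"
      using axis T_Cl by (auto simp: mperm_append E_perm transpos_def)
  next
    show "mperm (E @ T) (?P (int l)) = ?P (int l + 1)"
      by (simp add: mperm_append E_perm transpos_def T_far)
  next
    fix m assume "m > int l + 1"
    then show "mperm (E @ T) (?P m) = ?P m"
      by (simp add: mperm_append E_perm transpos_def T_far P_inj)
  qed (use inv E_legal E_perm axis in auto)
  have "\<bar>?P (int l + 1) $ j\<bar> \<le> int l + 1" for j
    by (simp add: smul_def e unitv_def)
  then have "cube 0 (int l) \<union> {?P (int l + 1)} \<subseteq> cube 0 (int l + 1)"
    by (auto simp: cube_def intro: order_trans)
  then show "sites_of E \<subseteq> cube 0 (int l + 1)" "sites_of (E @ T) \<subseteq> cube 0 (int l + 1)"
    using E_sites T_sites by auto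
qed

section \<open>Choice of the constant and conclusion\<close>

theorem mainTheorem1:
  fixes c :: "('d::finite) site \<Rightarrow> 'd site \<Rightarrow> 'd config \<Rightarrow> real"
    and Cl :: "'d site set"
  assumes "KCLG c" and "noncooperative c" and "mobile_cluster c Cl"
  shows "\<exists>K>0. \<forall>q L f. 0 < q \<longrightarrow> q < 1 \<longrightarrow>
           var q L f \<le> K * inverse (q ^ (card Cl + 1)) * (real L)\<^sup>2 * dirichlet_r c q L f"
proof -
  obtain cmax where bnd: "\<And>x y \<eta>. nbr x y \<Longrightarrow> c x y \<eta> = 0 \<or> (1 \<le> c x y \<eta> \<and> c x y \<eta> \<le> cmax)"
    using assms(1)[unfolded KCLG_def, THEN conjunct1] by blast
  have mono: "\<And>x y \<eta> \<eta>'. nbr x y \<Longrightarrow> (\<And>z. \<eta> z \<Longrightarrow> \<eta>' z) \<Longrightarrow> c x y \<eta>' \<le> c x y \<eta>"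
    and inv: "\<And>x y z \<eta>. nbr x y \<Longrightarrow> c x y \<eta> = c (x + z) (y + z) (transl z \<eta>)"
    using assms(1)[unfolded KCLG_def, THEN conjunct2, THEN conjunct2, THEN conjunct2, THEN conjunct1]
      assms(1)[unfolded KCLG_def, THEN conjunct2, THEN conjunct2, THEN conjunct2, THEN conjunct2,
        THEN conjunct1]
    by blast+
  have nonneg: "0 \<le> c x y \<eta>" if "nbr x y" for x y \<eta>
    using bnd[OF that, of \<eta>] by auto
  \<comment> \<open>Any coordinate will do, since leaving the box along one axis suffices.\<close>
  define i :: 'd where "i = undefined"
  define e where "e = unitv i 1"
  have "e \<in> dirs" unfolding e_def dirs_def by blast
  then obtain l T E where T: "translation_move c Cl e l T" and E: "exchange_move c Cl e l E"
    using assms(3) unfolding mobile_cluster_def by blast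
  note car = carrying_append[OF inv E T e_def]
  let ?A = "E @ T"
  \<comment> \<open>The weights \<open>4\<close> and \<open>1\<close> of the two moves come from
    \<open>exchange_energy_le\<close>; the added \<open>1\<close> makes \<open>K\<close> positive at
    once.\<close>
  define K where "K = 4 * (2 ^ length ?A * real (length ?A)) + 2 ^ length E * real (length E) + 1"
  have "K > 0" unfolding K_def by (intro add_nonneg_pos) auto
  moreover have "var q L f \<le> K * inverse (q ^ (card Cl + 1)) * (real L)\<^sup>2 * dirichlet_r c q L f"
    if q01: "0 < q" "q < 1" for q L f
  proof (cases "L = 0")
    case True
    \<comment> \<open>The variance is then at most an empty sum and the right-hand side vanishes;
      the exchange estimate needs a distance of at least one.\<close>
    have "box 0 = ({} :: 'd site set)"
      by (auto simp: box_def)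
    then show ?thesis using var_le_flip_energy[of q L f] q01 True by simp
  next
    case False
    interpret carrying c Cl e "int l" E ?A by (rule car)
    interpret carrying_in_box c Cl e "int l" E ?A q
      by unfold_locales (use q01 nonneg mono in auto)
    let ?D = "dirichlet_r c q L f"
    have D: "0 \<le> (real L)\<^sup>2 * ?D" by (simp add: dirichlet_r_nonneg)
    have "2 * (q ^ card Cl * var q L f) \<le> (real L)\<^sup>2 * ((K - 1) * (2 * ?D))"
      unfolding K_def add_diff_cancel_right'
      using False car
      by (intro variance_bound[OF _ e_def]) auto
    then have "q ^ card Cl * var q L f \<le> (K - 1) * ((real L)\<^sup>2 * ?D)"
      by (simp add: algebra_simps)
    also have "\<dots> \<le> K * ((real L)\<^sup>2 * ?D)" by (rule mult_right_mono[OF _ D]) simp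
    finally have "var q L f \<le> K * ((real L)\<^sup>2 * ?D) * inverse (q ^ card Cl)"
      using q01 by (simp add: field_simps)
    \<comment> \<open>As \<open>q < 1\<close>, the larger exponent only enlarges the bound.\<close>
    also have "\<dots> \<le> K * ((real L)\<^sup>2 * ?D) * inverse (q ^ (card Cl + 1))"
    proof (rule mult_left_mono)
      show "inverse (q ^ card Cl) \<le> inverse (q ^ (card Cl + 1))"
        using q01 by (intro le_imp_inverse_le power_decreasing) auto
      show "0 \<le> K * ((real L)\<^sup>2 * ?D)" using D \<open>K > 0\<close> by simp
    qed
    finally show ?thesis by (simp add: mult_ac)
  qed
  ultimately show ?thesis by blast
qed

end
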